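(* Let $S\subset\mathbb{R}^2$ be a compact set such that $\partial S$ is path-connected and $S=\overline{\mathrm{int}(S)}$. Let $\mathcal{X}_n=\{X_1,\dots,X_n\}$, where $X_1,X_2,\dots$ are independent and identically distributed with a distribution $P_X$ whose support is $S$, and assume that $S$ is standard with respect to $P_X$. Then for all $\theta\in[0,\pi/2)$, with probability one, as $n\to\infty$, $$d_H(\mathbb{B}_\theta(\mathcal{X}_n),\mathbb{B}_\theta(S))=\mathcal{O}\big((\log(n)/n)^{1/2}\big),\qquad d_H(\partial\mathbb{B}_\theta(S),\partial\mathbb{B}_\theta(\mathcal{X}_n))=\mathcal{O}\big((\log(n)/n)^{1/2}\big).$$ If moreover for all $\theta\in[0,\pi/2)$ the Minkowski content of $\partial\mathbb{B}_\theta(S)$ exists (and is finite), then also, with probability one, $$d_\mu(\mathbb{B}_\theta(\mathcal{X}_n),\mathbb{B}_\theta(S))=\mathcal{O}\big((\log(n)/n)^{1/2}\big).$$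
   Context: $\mathbb{R}^2$ carries the Euclidean norm $\|\cdot\|$ and inner product $\langle\cdot,\cdot\rangle$; $\partial$, $\mathrm{int}$, overline and superscript $c$ denote boundary, interior, closure and complement; $\mu$ is Lebesgue measure on $\mathbb{R}^2$; $B(x,\epsilon)$ is the closed ball; the support of a distribution is the smallest closed set of probability one. For $\theta\in[0,\pi/2)$ put $b_1=(\cos\theta,\sin\theta)$, $b_2=(-\sin\theta,\cos\theta)$, $\xi=(b_1+b_2)/\|b_1+b_2\|$. Let $R$ be the counter-clockwise rotation of angle $\pi/2$ about the origin, $R^0(\xi)=\xi$, $R^i(\xi)=R(R^{i-1}(\xi))$. For a unit vector $v$ and $x\in\mathbb{R}^2$, $C_v(x)=\{z\neq x:\langle v,(z-x)/\|z-x\|\rangle>\cos(\pi/4)\}$ (open quadrant with vertex $x$ and axis $v$). The $\theta$-biconvex hull of $A\subset\mathbb{R}^2$ is $$\mathbb{B}_\theta(A)=\bigcap\big\{(C_{R^i(\xi)}(y))^c:\ i\in\{0,1,2,3\},\ y\in\mathbb{R}^2,\ C_{R^i(\xi)}(y)\cap A=\emptyset\big\}.$$ For non-empty compact $A,C$: $d_H(A,C)=\max\{\max_{a\in A}d(a,C),\max_{c\in C}d(c,A)\}$, with $d(x,A)=\inf_{a\in A}\|x-a\|$; and $d_\mu(A,C)=\mu(A\triangle C)$. A set $S\subset\mathbb{R}^2$ is standard with respect to a Borel measure $\nu$ if there exist $\lambda>0$, $\delta>0$ such that $\nu(B(x,\epsilon)\cap S)\geq\delta\mu(B(x,\epsilon))$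 for all $x\in S$ and $0<\epsilon\leq\lambda$. The Minkowski content of $\partial T$ ($T$ compact) is $\lim_{\epsilon\to0}\mu(B(\partial T,\epsilon))/(2\epsilon)$, where $B(\partial T,\epsilon)=\bigcup_{t\in\partial T}B(t,\epsilon)$, provided the limit exists and is finite. *)

theory Defs
  imports "HOL-Probability.Probability" "HOL-Library.Landau_Symbols"
begin

definition b1 :: "real \<Rightarrow> real ^ 2" where
  "b1 \<theta> = vector [cos \<theta>, sin \<theta>]"

definition b2 :: "real \<Rightarrow> real ^ 2" where
  "b2 \<theta> = vector [- sin \<theta>, cos \<theta>]"

definition xi :: "real \<Rightarrow> real ^ 2" where
  "xi \<theta> = (b1 \<theta> + b2 \<theta>) /\<^sub>R norm (b1 \<theta> + b2 \<theta>)"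

(* Counter-clockwise rotation by pi/2 about the origin. *)
definition rot90 :: "real ^ 2 \<Rightarrow> real ^ 2" where
  "rot90 v = vector [- (v $ 2), v $ 1]"

definition quadrant :: "real ^ 2 \<Rightarrow> real ^ 2 \<Rightarrow> (real ^ 2) set" where
  "quadrant v x = {z. z \<noteq> x \<and> v \<bullet> ((z - x) /\<^sub>R norm (z - x)) > cos (pi / 4)}"

definition biconvex_hull :: "real \<Rightarrow> (real ^ 2) set \<Rightarrow> (real ^ 2) set" where
  "biconvex_hull \<theta> A =
     \<Inter> {- quadrant ((rot90 ^^ i) (xi \<theta>)) y | i y.
          i \<in> {0, 1, 2, 3} \<and> quadrant ((rot90 ^^ i) (xi \<theta>)) y \<inter> A = {}}"

(* Intended for non-empty compact sets, where the suprema are attained maxima. *)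
definition hausdorff_distance :: "'a::metric_space set \<Rightarrow> 'a set \<Rightarrow> real" where
  "hausdorff_distance A C = max (SUP a\<in>A. infdist a C) (SUP c\<in>C. infdist c A)"

definition measure_distance :: "'a::euclidean_space set \<Rightarrow> 'a set \<Rightarrow> real" where
  "measure_distance A C = measure lebesgue (sym_diff A C)"

definition is_support :: "'a::topological_space measure \<Rightarrow> 'a set \<Rightarrow> bool" where
  "is_support \<nu> S \<longleftrightarrow>
     closed S \<and> measure \<nu> S = 1 \<and> (\<forall>C. closed C \<and> measure \<nu> C = 1 \<longrightarrow> S \<subseteq> C)"

definition standard_wrt :: "'a::euclidean_space set \<Rightarrow> 'a measure \<Rightarrow> bool" where
  "standard_wrt S \<nu> \<longleftrightarrow>
     (\<exists>r>0. \<exists>\<delta>>0. \<forall>x\<in>S. \<forall>\<epsilon>. 0 < \<epsilon> \<and> \<epsilon> \<le> r \<longrightarrow>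
        emeasure \<nu> (cball x \<epsilon> \<inter> S) \<ge> ennreal \<delta> * emeasure lebesgue (cball x \<epsilon>))"

definition has_minkowski_content_frontier :: "(real ^ 2) set \<Rightarrow> real \<Rightarrow> bool" where
  "has_minkowski_content_frontier T L \<longleftrightarrow>
     ((\<lambda>\<epsilon>. measure lebesgue (\<Union>t\<in>frontier T. cball t \<epsilon>) / (2 * \<epsilon>)) \<longlongrightarrow> L) (at_right 0)"

end

theory Submission
  imports Defs "HOL-Real_Asymp.Real_Asymp"
begin

text \<open>
  In the orthonormal coordinates given by \<open>b1 \<theta>\<close> and \<open>b2 \<theta>\<close>, a point belongs to the hull of a
  compact set iff each of its four closed coordinate quadrants meets the set. Suppose that the
  sample \<open>A \<subseteq> S\<close> is \<open>e\<close>-dense in \<open>S\<close>. A quadrant missing \<open>A\<close> becomes one missing \<open>S\<close> after moving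
  its vertex by \<open>O(e)\<close> along its axis, so every point outside the hull of \<open>A\<close> is \<open>O(e)\<close>-close to the
  complement of the hull of \<open>S\<close>; this yields the statement on boundaries and, through the Minkowski
  content, the one on measures. Conversely let \<open>x\<close> be in the hull of \<open>S\<close>. Either \<open>S\<close> comes within
  \<open>O(e)\<close> of \<open>x\<close>, or \<open>S\<close>, being connected, has to go around a small box at \<open>x\<close> from one arm to the next,
  and then the four quadrants at \<open>x\<close> or at a point near \<open>x\<close> are hit with a margin \<open>e\<close>, hence are hit by \<open>A\<close>.
  The density \<open>e\<close> is of order \<open>sqrt (ln n / n)\<close> almost surely by a covering argument and Borel--Cantelli.
\<close>

subsection \<open>The hull in coordinates\<close>

lemma b1_b2_orthonormal:
  "b1 \<theta> \<bullet> b1 \<theta> = 1" "b2 \<theta> \<bullet> b2 \<theta> = 1" "b1 \<theta> \<bullet> b2 \<theta> = 0" "b2 \<theta> \<bullet> b1 \<theta> = 0"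
  by (simp_all add: b1_def b2_def inner_vec_def sum_2 flip: power2_eq_square)

lemma norm_b1_b2: "norm (b1 \<theta>) = 1" "norm (b2 \<theta>) = 1"
  by (simp_all add: norm_eq_sqrt_inner b1_b2_orthonormal)

lemma b1_b2_expansion: "z = (b1 \<theta> \<bullet> z) *\<^sub>R b1 \<theta> + (b2 \<theta> \<bullet> z) *\<^sub>R b2 \<theta>"
proof -
  have *: "(c * x + s * y) * c - (c * y - s * x) * s = (c\<^sup>2 + s\<^sup>2) * x"
    "(c * x + s * y) * s + (c * y - s * x) * c = (c\<^sup>2 + s\<^sup>2) * y" for c s x y :: real
    by algebra+
  show ?thesis
    using *[of "cos \<theta>" "z$1" "sin \<theta>" "z$2"]
    by (simp add: vec_eq_iff forall_2 b1_def b2_def inner_vec_def sum_2)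
qed

lemma norm_le_b1_b2: "norm z \<le> \<bar>b1 \<theta> \<bullet> z\<bar> + \<bar>b2 \<theta> \<bullet> z\<bar>"
proof -
  have "norm z = norm ((b1 \<theta> \<bullet> z) *\<^sub>R b1 \<theta> + (b2 \<theta> \<bullet> z) *\<^sub>R b2 \<theta>)"
    by (metis b1_b2_expansion)
  also have "\<dots> \<le> norm ((b1 \<theta> \<bullet> z) *\<^sub>R b1 \<theta>) + norm ((b2 \<theta> \<bullet> z) *\<^sub>R b2 \<theta>)"
    by (rule norm_triangle_ineq)
  finally show ?thesis
    by (simp add: norm_b1_b2)
qed

lemma norm_b1_b2_coords: "norm z = sqrt ((b1 \<theta> \<bullet> z)\<^sup>2 + (b2 \<theta> \<bullet> z)\<^sup>2)"
proof -
  have "z \<bullet> z = ((b1 \<theta> \<bullet> z) *\<^sub>R b1 \<theta> + (b2 \<theta> \<bullet> z) *\<^sub>R b2 \<theta>) \<bullet> ((b1 \<theta> \<bullet> z) *\<^sub>R b1 \<theta> + (b2 \<theta> \<bullet> z) *\<^sub>R b2 \<theta>)"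
    by (metis b1_b2_expansion)
  then show ?thesis
    by (simp add: norm_eq_sqrt_inner inner_add_left inner_add_right b1_b2_orthonormal power2_eq_square)
qed

lemma xi_eq: "xi \<theta> = (b1 \<theta> + b2 \<theta>) /\<^sub>R sqrt 2"
  by (simp add: xi_def norm_eq_sqrt_inner inner_add_left inner_add_right b1_b2_orthonormal)

lemma rot90_scaleR: "rot90 (c *\<^sub>R v) = c *\<^sub>R rot90 v"
  by (simp add: rot90_def vec_eq_iff forall_2)

lemma rot90_add: "rot90 (v + w) = rot90 v + rot90 w"
  by (simp add: rot90_def vec_eq_iff forall_2)

lemma rot90_diff: "rot90 (v - w) = rot90 v - rot90 w"
  by (simp add: rot90_def vec_eq_iff forall_2)

lemma rot90_minus: "rot90 (- v) = - rot90 v"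
  by (simp add: rot90_def vec_eq_iff forall_2)

lemma rot90_b1: "rot90 (b1 \<theta>) = b2 \<theta>"
  and rot90_b2: "rot90 (b2 \<theta>) = - b1 \<theta>"
  by (simp_all add: rot90_def b1_def b2_def vec_eq_iff forall_2)

text \<open>The root dominates \<open>\<bar>a\<bar>\<close> and \<open>\<bar>b\<bar>\<close>, so the
  strict bound leaves each summand positive; conversely \<open>2 * a * b > 0\<close> makes the
  square of the sum larger. This is how an angle condition turns into two sign conditions.\<close>

lemma sqrt_sum_squares_less_add_iff:
  fixes a b :: real
  shows "sqrt (a\<^sup>2 + b\<^sup>2) < a + b \<longleftrightarrow> 0 < a \<and> 0 < b"
proof
  assume *: "sqrt (a\<^sup>2 + b\<^sup>2) < a + b"
  then have "\<bar>a\<bar> < a + b" "\<bar>b\<bar> < a + b"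
    using real_sqrt_sum_squares_ge1[of a b] abs_le_square_iff real_sqrt_sum_squares_ge2[of b a]
    by (smt (verit) real_sqrt_abs real_sqrt_le_iff zero_le_power2)+
  then show "0 < a \<and> 0 < b" by linarith
next
  assume "0 < a \<and> 0 < b"
  then show "sqrt (a\<^sup>2 + b\<^sup>2) < a + b"
    by (intro real_less_lsqrt) (auto simp: power2_sum)
qed

text \<open>With \<open>a\<close>, \<open>b\<close> the signed coordinates of \<open>z - y\<close>,
  the cosine of the angle to the axis is \<open>(a + b) / (sqrt 2 * norm (z - y))\<close>. Comparing
  it with \<open>cos (pi / 4) = sqrt 2 / 2\<close> leaves \<open>norm (z - y) < a + b\<close>, which
  says that both coordinates are positive.\<close>

lemma quadrant_axis_iff:
  assumes "\<bar>p\<bar> = 1" "\<bar>q\<bar> = 1"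
  shows "z \<in> quadrant ((p *\<^sub>R b1 \<theta> + q *\<^sub>R b2 \<theta>) /\<^sub>R sqrt 2) y \<longleftrightarrow>
    p * (b1 \<theta> \<bullet> y) < p * (b1 \<theta> \<bullet> z) \<and> q * (b2 \<theta> \<bullet> y) < q * (b2 \<theta> \<bullet> z)"
proof (cases "z = y")
  case False
  define a b where "a = p * (b1 \<theta> \<bullet> (z - y))" and "b = q * (b2 \<theta> \<bullet> (z - y))"
  have sq: "a\<^sup>2 + b\<^sup>2 = (b1 \<theta> \<bullet> (z - y))\<^sup>2 + (b2 \<theta> \<bullet> (z - y))\<^sup>2"
    using assms by (simp add: a_def b_def power_mult_distrib flip: power2_abs[of p] power2_abs[of q])
  have n: "norm (z - y) = sqrt (a\<^sup>2 + b\<^sup>2)"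
    unfolding sq by (rule norm_b1_b2_coords)
  have pos: "0 < norm (z - y)" using False by simp
  have "z \<in> quadrant ((p *\<^sub>R b1 \<theta> + q *\<^sub>R b2 \<theta>) /\<^sub>R sqrt 2) y \<longleftrightarrow>
      sqrt 2 / 2 < (a + b) / (sqrt 2 * norm (z - y))"
    using False by (simp add: quadrant_def cos_45 a_def b_def inner_add_left divide_simps mult_ac)
  also have "\<dots> \<longleftrightarrow> norm (z - y) < a + b"
  proof -
    have "1 / sqrt 2 = sqrt 2 / (2::real)"
      by (simp add: field_simps)
    then have "(a + b) / (sqrt 2 * norm (z - y)) = sqrt 2 / 2 * ((a + b) / norm (z - y))"
      by (metis mult.commute times_divide_times_eq mult_1)
    then show ?thesis
      using pos by (simp add: less_divide_eq)
  qed
  also have "\<dots> \<longleftrightarrow> 0 < a \<and> 0 < b"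
    unfolding n by (rule sqrt_sum_squares_less_add_iff)
  finally show ?thesis
    by (simp add: a_def b_def inner_diff_right right_diff_distrib)
qed (simp add: quadrant_def)

text \<open>Trading the number of rotations for a pair of signs lets one argument with parameters
  \<open>p\<close>, \<open>q\<close> treat all four directions at once.\<close>

lemma rot90_axes:
  "{(rot90 ^^ i) (xi \<theta>) | i. i \<in> {0, 1, 2, 3}} =
   {(p *\<^sub>R b1 \<theta> + q *\<^sub>R b2 \<theta>) /\<^sub>R sqrt 2 | p q :: real. \<bar>p\<bar> = 1 \<and> \<bar>q\<bar> = 1}"
proof -
  have l: "{(rot90 ^^ i) (xi \<theta>) | i. i \<in> {0, 1, 2, 3}} =
      {xi \<theta>, rot90 (xi \<theta>), rot90 (rot90 (xi \<theta>)), rot90 (rot90 (rot90 (xi \<theta>)))}"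
  proof -
    have "{(rot90 ^^ i) (xi \<theta>) | i. i \<in> {0, 1, 2, 3}} = (\<lambda>i. (rot90 ^^ i) (xi \<theta>)) ` {0, 1, 2, 3}"
      by blast
    then show ?thesis
      by (simp add: numeral_2_eq_2 numeral_3_eq_3)
  qed
  have u: "\<bar>p\<bar> = 1 \<longleftrightarrow> p = 1 \<or> p = - 1" for p :: real by linarith
  have r: "{(p *\<^sub>R b1 \<theta> + q *\<^sub>R b2 \<theta>) /\<^sub>R sqrt 2 | p q :: real. \<bar>p\<bar> = 1 \<and> \<bar>q\<bar> = 1} =
    {(b1 \<theta> + b2 \<theta>) /\<^sub>R sqrt 2, (b1 \<theta> - b2 \<theta>) /\<^sub>R sqrt 2, (- b1 \<theta> + b2 \<theta>) /\<^sub>R sqrt 2, (- b1 \<theta> - b2 \<theta>) /\<^sub>R sqrt 2}"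
  proof -
    have "{(p *\<^sub>R b1 \<theta> + q *\<^sub>R b2 \<theta>) /\<^sub>R sqrt 2 | p q :: real. \<bar>p\<bar> = 1 \<and> \<bar>q\<bar> = 1} =
        (\<Union>p\<in>{1, - 1}. (\<lambda>q. (p *\<^sub>R b1 \<theta> + q *\<^sub>R b2 \<theta>) /\<^sub>R sqrt 2) ` {1, - 1})"
      unfolding u by blast
    then show ?thesis
      by (simp add: insert_commute)
  qed
  show ?thesis
    unfolding l r by (auto simp: xi_eq rot90_scaleR rot90_add rot90_diff rot90_minus rot90_b1 rot90_b2)
qed

lemma biconvex_hull_eq:
  "biconvex_hull \<theta> A = \<Inter> {- quadrant ((p *\<^sub>R b1 \<theta> + q *\<^sub>R b2 \<theta>) /\<^sub>R sqrt 2) y | p q y.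
     \<bar>p\<bar> = 1 \<and> \<bar>q\<bar> = 1 \<and> quadrant ((p *\<^sub>R b1 \<theta> + q *\<^sub>R b2 \<theta>) /\<^sub>R sqrt 2) y \<inter> A = {}}"
proof -
  have "biconvex_hull \<theta> A = \<Inter> {- quadrant v y | v y. v \<in> {(rot90 ^^ i) (xi \<theta>) | i. i \<in> {0, 1, 2, 3}} \<and>
      quadrant v y \<inter> A = {}}"
    unfolding biconvex_hull_def by (rule arg_cong[of _ _ Inter]) blast
  also have "\<dots> = \<Inter> {- quadrant ((p *\<^sub>R b1 \<theta> + q *\<^sub>R b2 \<theta>) /\<^sub>R sqrt 2) y | p q y.
     \<bar>p\<bar> = 1 \<and> \<bar>q\<bar> = 1 \<and> quadrant ((p *\<^sub>R b1 \<theta> + q *\<^sub>R b2 \<theta>) /\<^sub>R sqrt 2) y \<inter> A = {}}"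
    unfolding rot90_axes by (rule arg_cong[of _ _ Inter]) blast
  finally show ?thesis .
qed

lemma b1_b2_coords:
  "b1 \<theta> \<bullet> (a *\<^sub>R b1 \<theta> + b *\<^sub>R b2 \<theta>) = a" "b2 \<theta> \<bullet> (a *\<^sub>R b1 \<theta> + b *\<^sub>R b2 \<theta>) = b"
  by (simp_all add: inner_add_right b1_b2_orthonormal)

text \<open>Every pair of thresholds \<open>a\<close>, \<open>b\<close> comes from a vertex, so
  quantifying over vertices amounts to quantifying over thresholds; the definition is then read in
  contraposed form.\<close>

lemma mem_biconvex_hull_iff:
  "x \<in> biconvex_hull \<theta> A \<longleftrightarrow> (\<forall>p q a b. \<bar>p\<bar> = 1 \<longrightarrow> \<bar>q\<bar> = 1 \<longrightarrow>
     a < p * (b1 \<theta> \<bullet> x) \<longrightarrow> b < q * (b2 \<theta> \<bullet> x) \<longrightarrow> (\<exists>s\<in>A. a < p * (b1 \<theta> \<bullet> s) \<and> b < q * (b2 \<theta> \<bullet> s)))"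
    (is "?L \<longleftrightarrow> ?R")
proof
  assume L: ?L
  show ?R
  proof (intro allI impI)
    fix p q a b :: real
    assume pq: "\<bar>p\<bar> = 1" "\<bar>q\<bar> = 1" and lt: "a < p * (b1 \<theta> \<bullet> x)" "b < q * (b2 \<theta> \<bullet> x)"
    \<comment> \<open>Since \<open>p * p = q * q = 1\<close>, the signed coordinates of this vertex
      are exactly \<open>a\<close> and \<open>b\<close>.\<close>
    define y where "y = (p * a) *\<^sub>R b1 \<theta> + (q * b) *\<^sub>R b2 \<theta>"
    have "p * p = 1" "q * q = 1"
      using pq by (metis abs_mult_self_eq mult_1)+
    then have y: "p * (b1 \<theta> \<bullet> y) = a" "q * (b2 \<theta> \<bullet> y) = b"
      by (simp_all add: y_def b1_b2_coords flip: mult.assoc)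
    have "x \<in> quadrant ((p *\<^sub>R b1 \<theta> + q *\<^sub>R b2 \<theta>) /\<^sub>R sqrt 2) y"
      using pq lt y by (simp add: quadrant_axis_iff)
    then have "quadrant ((p *\<^sub>R b1 \<theta> + q *\<^sub>R b2 \<theta>) /\<^sub>R sqrt 2) y \<inter> A \<noteq> {}"
      using L pq unfolding biconvex_hull_eq by blast
    then show "\<exists>s\<in>A. a < p * (b1 \<theta> \<bullet> s) \<and> b < q * (b2 \<theta> \<bullet> s)"
      using pq y by (auto simp: quadrant_axis_iff)
  qed
next
  assume R: ?R
  show ?L
    unfolding biconvex_hull_eq
  proof clarify
    fix p q y
    assume pq: "\<bar>p\<bar> = (1::real)" "\<bar>q\<bar> = (1::real)"
      and "quadrant ((p *\<^sub>R b1 \<theta> + q *\<^sub>R b2 \<theta>) /\<^sub>R sqrt 2) y \<inter> A = {}"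
      and "x \<in> quadrant ((p *\<^sub>R b1 \<theta> + q *\<^sub>R b2 \<theta>) /\<^sub>R sqrt 2) y"
    then show False
      using R[rule_format, OF pq, of "p * (b1 \<theta> \<bullet> y)" "q * (b2 \<theta> \<bullet> y)"]
      by (auto simp: quadrant_axis_iff[OF pq] disjoint_iff)
  qed
qed

lemma biconvex_hullI:
  assumes "\<And>p q. \<bar>p\<bar> = 1 \<Longrightarrow> \<bar>q\<bar> = 1 \<Longrightarrow>
    \<exists>s\<in>A. p * (b1 \<theta> \<bullet> x) \<le> p * (b1 \<theta> \<bullet> s) \<and> q * (b2 \<theta> \<bullet> x) \<le> q * (b2 \<theta> \<bullet> s)"
  shows "x \<in> biconvex_hull \<theta> A"
  unfolding mem_biconvex_hull_iff using assms by (meson less_le_trans)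

text \<open>Compactness passes from open quadrants with vertices just behind \<open>x\<close> to the
  closed quadrant at \<open>x\<close>. The slack \<open>m\<close> attains its maximum on
  \<open>A\<close>; were it negative, the open quadrant pushed back by exactly that amount would
  contain a point of larger slack.\<close>

lemma biconvex_hullD:
  assumes "compact A" "x \<in> biconvex_hull \<theta> A" "\<bar>p\<bar> = 1" "\<bar>q\<bar> = 1"
  shows "\<exists>s\<in>A. p * (b1 \<theta> \<bullet> x) \<le> p * (b1 \<theta> \<bullet> s) \<and> q * (b2 \<theta> \<bullet> x) \<le> q * (b2 \<theta> \<bullet> s)"
proof -
  define m where "m s = min (p * (b1 \<theta> \<bullet> s) - p * (b1 \<theta> \<bullet> x)) (q * (b2 \<theta> \<bullet> s) - q * (b2 \<theta> \<bullet> x))" for s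
  have hit: "\<exists>s\<in>A. - e < m s" if "0 < e" for e
    using assms(2)[unfolded mem_biconvex_hull_iff, rule_format, OF assms(3,4),
        of "p * (b1 \<theta> \<bullet> x) - e" "q * (b2 \<theta> \<bullet> x) - e"] that
    by (force simp: m_def)
  have "A \<noteq> {}"
    using hit[of 1] by auto
  moreover have "continuous_on A m"
    unfolding m_def by (intro continuous_intros)
  ultimately obtain s where s: "s \<in> A" "\<And>t. t \<in> A \<Longrightarrow> m t \<le> m s"
    using continuous_attains_sup[OF assms(1)] by blast
  have "0 \<le> m s"
  proof (rule ccontr)
    assume "\<not> 0 \<le> m s"
    then obtain t where "t \<in> A" "m s < m t" using hit[of "- m s"] by auto
    then show False using s(2)[of t] by simp
  qed
  then show ?thesis using s(1) by (auto simp: m_def)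
qed

lemma subset_biconvex_hull: "A \<subseteq> biconvex_hull \<theta> A"
proof
  fix x assume "x \<in> A"
  then show "x \<in> biconvex_hull \<theta> A"
    by (intro biconvex_hullI bexI[of _ x]) auto
qed

lemma biconvex_hull_mono: "A \<subseteq> A' \<Longrightarrow> biconvex_hull \<theta> A \<subseteq> biconvex_hull \<theta> A'"
  unfolding biconvex_hull_def by (rule Inter_anti_mono) blast

lemma closed_biconvex_hull: "closed (biconvex_hull \<theta> A)"
proof -
  have "open {z. p * (b1 \<theta> \<bullet> y) < p * (b1 \<theta> \<bullet> z) \<and> q * (b2 \<theta> \<bullet> y) < q * (b2 \<theta> \<bullet> z)}" for p q y
    by (intro open_Collect_conj open_Collect_less continuous_intros)
  moreover have "quadrant ((p *\<^sub>R b1 \<theta> + q *\<^sub>R b2 \<theta>) /\<^sub>R sqrt 2) y =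
      {z. p * (b1 \<theta> \<bullet> y) < p * (b1 \<theta> \<bullet> z) \<and> q * (b2 \<theta> \<bullet> y) < q * (b2 \<theta> \<bullet> z)}"
    if "\<bar>p\<bar> = 1" "\<bar>q\<bar> = 1" for p q y
    by (rule set_eqI) (simp only: quadrant_axis_iff[OF that] mem_Collect_eq)
  ultimately have "closed (- quadrant ((p *\<^sub>R b1 \<theta> + q *\<^sub>R b2 \<theta>) /\<^sub>R sqrt 2) y)"
    if "\<bar>p\<bar> = 1" "\<bar>q\<bar> = 1" for p q y
    using that by (simp only: closed_Compl)
  then show ?thesis
    unfolding biconvex_hull_eq by (intro closed_Inter) blast
qed

lemma abs_b1_b2_le: "\<bar>b1 \<theta> \<bullet> z\<bar> \<le> norm z" "\<bar>b2 \<theta> \<bullet> z\<bar> \<le> norm z"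
  using Cauchy_Schwarz_ineq2[of "b1 \<theta>" z] Cauchy_Schwarz_ineq2[of "b2 \<theta>" z] by (auto simp: norm_b1_b2)

lemma compact_biconvex_hull:
  assumes "compact A"
  shows "compact (biconvex_hull \<theta> A)"
proof -
  obtain r where r: "\<And>s. s \<in> A \<Longrightarrow> norm s \<le> r"
    using compact_imp_bounded[OF assms] by (auto simp: bounded_iff)
  have "norm x \<le> 2 * r" if x: "x \<in> biconvex_hull \<theta> A" for x
  proof -
    \<comment> \<open>Two opposite quadrants suffice: equal signs \<open>1\<close> bound both
      coordinates from above, equal signs \<open>- 1\<close> bound them from below.\<close>
    have "p * (b1 \<theta> \<bullet> x) \<le> r \<and> p * (b2 \<theta> \<bullet> x) \<le> r" if p: "\<bar>p\<bar> = 1" for p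
    proof -
      obtain s where s: "s \<in> A" "p * (b1 \<theta> \<bullet> x) \<le> p * (b1 \<theta> \<bullet> s)" "p * (b2 \<theta> \<bullet> x) \<le> p * (b2 \<theta> \<bullet> s)"
        using biconvex_hullD[OF assms x p p] by blast
      have "\<bar>p * (b1 \<theta> \<bullet> s)\<bar> \<le> r" "\<bar>p * (b2 \<theta> \<bullet> s)\<bar> \<le> r"
        using abs_b1_b2_le[of \<theta> s] r[OF s(1)] p by (simp_all add: abs_mult)
      then show ?thesis using s by linarith
    qed
    from this[of 1] this[of "- 1"] show ?thesis
      using norm_le_b1_b2[of x \<theta>] by auto
  qed
  then have "bounded (biconvex_hull \<theta> A)"
    by (rule boundedI)
  then show ?thesis
    using closed_biconvex_hull compact_eq_bounded_closed by blast
qed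

lemma abs_b1_b2_diff_le:
  "\<bar>b1 \<theta> \<bullet> x - b1 \<theta> \<bullet> y\<bar> \<le> dist x y" "\<bar>b2 \<theta> \<bullet> x - b2 \<theta> \<bullet> y\<bar> \<le> dist x y"
  using abs_b1_b2_le[where z = "x - y"] by (simp_all add: inner_diff_right dist_norm)

subsection \<open>Connected sets going around a box\<close>

text \<open>Here \<open>f\<close>, \<open>g\<close> stand for coordinates relative to a hull point
  and \<open>(\<alpha>, \<beta>)\<close> for a shifted vertex. The margin \<open>e\<close> is what
  an \<open>e\<close>-dense sample may lose; a shift of \<open>2 * e\<close> plus the margin adds up
  to the half-side \<open>3 * e\<close> of the box used below.\<close>

definition hits_robustly :: "('a \<Rightarrow> real) \<Rightarrow> ('a \<Rightarrow> real) \<Rightarrow> 'a set \<Rightarrow> real \<Rightarrow> bool" where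
  "hits_robustly f g S e \<longleftrightarrow> (\<exists>\<alpha> \<beta>. \<bar>\<alpha>\<bar> \<le> 2 * e \<and> \<bar>\<beta>\<bar> \<le> 2 * e \<and>
     (\<exists>s\<in>S. \<alpha> + e \<le> f s \<and> \<beta> + e \<le> g s) \<and> (\<exists>s\<in>S. f s \<le> \<alpha> - e \<and> \<beta> + e \<le> g s) \<and>
     (\<exists>s\<in>S. f s \<le> \<alpha> - e \<and> g s \<le> \<beta> - e) \<and> (\<exists>s\<in>S. \<alpha> + e \<le> f s \<and> g s \<le> \<beta> - e))"

text \<open>This symmetry and the two reflections after it reduce the later case analysis to one
  missed corner and one arm of the box.\<close>

lemma hits_robustly_swap: "hits_robustly g f S e \<Longrightarrow> hits_robustly f g S e"
  unfolding hits_robustly_def by blast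

lemma hits_robustly_uminus1:
  assumes "hits_robustly (\<lambda>s. - f s) g S e" shows "hits_robustly f g S e"
proof -
  have r: "\<alpha> + e \<le> - f s \<longleftrightarrow> f s \<le> -\<alpha> - e" "- f s \<le> \<alpha> - e \<longleftrightarrow> - \<alpha> + e \<le> f s" for \<alpha> s
    by linarith+
  obtain \<alpha> \<beta> where
    "\<bar>-\<alpha>\<bar> \<le> 2 * e \<and> \<bar>\<beta>\<bar> \<le> 2 * e \<and>
     (\<exists>s\<in>S. -\<alpha> + e \<le> f s \<and> \<beta> + e \<le> g s) \<and> (\<exists>s\<in>S. f s \<le> -\<alpha> - e \<and> \<beta> + e \<le> g s) \<and>
     (\<exists>s\<in>S. f s \<le> -\<alpha> - e \<and> g s \<le> \<beta> - e) \<and> (\<exists>s\<in>S. -\<alpha> + e \<le> f s \<and> g s \<le> \<beta> - e)"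
    using assms unfolding hits_robustly_def r abs_minus_cancel by blast
  then show ?thesis unfolding hits_robustly_def by blast
qed

lemma hits_robustly_uminus2:
  assumes "hits_robustly f (\<lambda>s. - g s) S e" shows "hits_robustly f g S e"
  using assms hits_robustly_swap hits_robustly_uminus1 by blast

text \<open>Connectedness is transferred to the image in the coordinate plane. The open sets
  \<open>U\<close> and \<open>V\<close> may overlap elsewhere; they need to be disjoint only on that
  image.\<close>

lemma connected_not_separated:
  assumes "connected S" "continuous_on S f" "continuous_on S g"
    "open U" "open V" "\<And>z. z \<in> S \<Longrightarrow> (f z, g z) \<in> U \<union> V" "\<And>z. z \<in> S \<Longrightarrow> (f z, g z) \<notin> U \<inter> V"
    "s \<in> S" "(f s, g s) \<in> U" "t \<in> S" "(f t, g t) \<in> V"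
  shows False
proof -
  have "connected ((\<lambda>z. (f z, g z)) ` S)"
    using assms by (intro connected_continuous_image continuous_intros)
  then have "U \<inter> (\<lambda>z. (f z, g z)) ` S = {} \<or> V \<inter> (\<lambda>z. (f z, g z)) ` S = {}"
    by (rule connectedD) (use assms(4-7) in auto)
  then show False
    using assms(8-) by blast
qed

text \<open>
  With the box \<open>\<bar>f\<bar>, \<bar>g\<bar> < 3 * e\<close> and the upper right corner missed, a set with a point in the upper arm
  and a point below right must pass through the upper left corner, the lower left corner and the
  lower right quadrant: missing any of these disconnects it. The shifted vertex is \<open>(- 2 * e, 0)\<close>.
\<close>

lemma hits_robustly_vertical:
  fixes f g :: "'a::topological_space \<Rightarrow> real"
  assumes S: "connected S" "continuous_on S f" "continuous_on S g" and "0 < e"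
    and box: "\<And>s. s \<in> S \<Longrightarrow> 3 * e \<le> \<bar>f s\<bar> \<or> 3 * e \<le> \<bar>g s\<bar>"
    and ne: "\<And>s. s \<in> S \<Longrightarrow> f s < 3 * e \<or> g s < 3 * e"
    and s: "s \<in> S" "0 \<le> f s" "3 * e \<le> g s" and t: "t \<in> S" "0 \<le> f t" "g t \<le> 0"
  shows "hits_robustly f g S e"
proof -
  define r where "r = 3 * e"
  have r: "0 < r" using \<open>0 < e\<close> by (simp add: r_def)
  note sep = connected_not_separated[OF S]
  have cont: "open {p::real\<times>real. P1 p < P2 p}" if "continuous_on UNIV P1" "continuous_on UNIV P2"
    for P1 P2 :: "real \<times> real \<Rightarrow> real"
    using that by (rule open_Collect_less)
  have nw: "\<exists>z\<in>S. f z \<le> - r \<and> r \<le> g z"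
  proof (rule ccontr)
    assume "\<not> ?thesis"
    then have c: "\<And>z. z \<in> S \<Longrightarrow> - r < f z \<or> g z < r" by force
    show False
    \<comment> \<open>The upper arm splits off: a point with \<open>r \<le> g\<close> has
      \<open>\<bar>f\<bar> < r\<close> by \<open>c\<close> and \<open>ne\<close>, and a point of the
      arm with \<open>g < r\<close> would lie in the box.\<close>
    proof (rule sep[of "{p. \<bar>fst p\<bar> < r} \<inter> {p. 0 < snd p}" "{p. snd p < r}" s t])
      show "open ({p::real\<times>real. \<bar>fst p\<bar> < r} \<inter> {p. 0 < snd p})" "open {p::real\<times>real. snd p < r}"
        by (intro open_Int cont continuous_intros)+
      show "(f z, g z) \<in> {p. \<bar>fst p\<bar> < r} \<inter> {p. 0 < snd p} \<union> {p. snd p < r}" if "z \<in> S" for z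
        using c[OF that] ne[folded r_def, OF that] r by auto
      show "(f z, g z) \<notin> ({p. \<bar>fst p\<bar> < r} \<inter> {p. 0 < snd p}) \<inter> {p. snd p < r}" if "z \<in> S" for z
        using box[folded r_def, OF that] by auto
    qed (use ne[folded r_def, OF s(1)] s[folded r_def] t r in auto)
  qed
  have sw: "\<exists>z\<in>S. f z \<le> - r \<and> g z \<le> - r"
  proof (rule ccontr)
    assume "\<not> ?thesis"
    then have c: "\<And>z. z \<in> S \<Longrightarrow> - r < f z \<or> - r < g z" by force
    show False
    \<comment> \<open>The diagonal separates: a point of \<open>S\<close> on it lies in the box, in
      the upper right corner or in the lower left one, and all three are excluded.\<close>
    proof (rule sep[of "{p. fst p < snd p}" "{p. snd p < fst p}" s t])
      show "open {p::real\<times>real. fst p < snd p}" "open {p::real\<times>real. snd p < fst p}"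
        by (intro cont continuous_intros)+
      show "(f z, g z) \<in> {p. fst p < snd p} \<union> {p. snd p < fst p}" if "z \<in> S" for z
        using c[OF that] box[folded r_def, OF that] ne[folded r_def, OF that] r by auto
      show "(f t, g t) \<in> {p. snd p < fst p}"
        using t box[folded r_def, OF t(1)] r by auto
    qed (use ne[folded r_def, OF s(1)] s[folded r_def] t r in auto)
  qed
  have se: "\<exists>z\<in>S. 0 \<le> f z \<and> g z \<le> - r"
  proof (rule ccontr)
    assume "\<not> ?thesis"
    then have c: "\<And>z. z \<in> S \<Longrightarrow> f z < 0 \<or> - r < g z" by force
    show False
    \<comment> \<open>Now the right arm splits off. Under \<open>c\<close> the point
      \<open>t\<close> has \<open>- r < g t\<close>, so being outside the box puts it into this
      arm.\<close>
    proof (rule sep[of "{p. fst p < r}" "{p. 0 < fst p} \<inter> {p. \<bar>snd p\<bar> < r}" s t])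
      show "open ({p::real\<times>real. 0 < fst p} \<inter> {p. \<bar>snd p\<bar> < r})" "open {p::real\<times>real. fst p < r}"
        by (intro open_Int cont continuous_intros)+
      show "(f z, g z) \<in> {p. fst p < r} \<union> {p. 0 < fst p} \<inter> {p. \<bar>snd p\<bar> < r}" if "z \<in> S" for z
        using c[OF that] ne[folded r_def, OF that] r by auto
      show "(f z, g z) \<notin> {p. fst p < r} \<inter> ({p. 0 < fst p} \<inter> {p. \<bar>snd p\<bar> < r})" if "z \<in> S" for z
        using box[folded r_def, OF that] by auto
      show "(f t, g t) \<in> {p. 0 < fst p} \<inter> {p. \<bar>snd p\<bar> < r}"
        using t box[folded r_def, OF t(1)] c[OF t(1)] r by auto
    qed (use ne[folded r_def, OF s(1)] s[folded r_def] t r in auto)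
  qed
  show ?thesis
    unfolding hits_robustly_def
  \<comment> \<open>On the right the requirement becomes \<open>- e \<le> f\<close>, which
    \<open>0 \<le> f\<close> gives for \<open>s\<close> and for the point from \<open>se\<close>; on
    the left it becomes \<open>f \<le> - 3 * e\<close>, which the two corner points satisfy.\<close>
  proof (rule exI[of _ "- 2 * e"], rule exI[of _ 0], intro conjI)
    show "\<exists>s\<in>S. - 2 * e + e \<le> f s \<and> 0 + e \<le> g s"
      using s \<open>0 < e\<close> by (intro bexI[of _ s]) auto
    show "\<exists>s\<in>S. f s \<le> - 2 * e - e \<and> 0 + e \<le> g s"
      using nw \<open>0 < e\<close> unfolding r_def by (elim bexE, intro bexI) auto
    show "\<exists>s\<in>S. f s \<le> - 2 * e - e \<and> g s \<le> 0 - e"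
      using sw \<open>0 < e\<close> unfolding r_def by (elim bexE, intro bexI) auto
    show "\<exists>s\<in>S. - 2 * e + e \<le> f s \<and> g s \<le> 0 - e"
      using se \<open>0 < e\<close> unfolding r_def by (elim bexE, intro bexI) auto
  qed (use \<open>0 < e\<close> in auto)
qed

text \<open>The point of the upper right quadrant lies outside the box, hence beyond its upper or
  its right side. The second case is the first one with the coordinates exchanged.\<close>

lemma hits_robustly_missed_corner:
  fixes f g :: "'a::topological_space \<Rightarrow> real"
  assumes S: "connected S" "continuous_on S f" "continuous_on S g" and "0 < e"
    and box: "\<And>s. s \<in> S \<Longrightarrow> 3 * e \<le> \<bar>f s\<bar> \<or> 3 * e \<le> \<bar>g s\<bar>"
    and ne: "\<And>s. s \<in> S \<Longrightarrow> f s < 3 * e \<or> g s < 3 * e"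
    and q: "\<exists>s\<in>S. 0 \<le> f s \<and> 0 \<le> g s" "\<exists>s\<in>S. f s \<le> 0 \<and> 0 \<le> g s" "\<exists>s\<in>S. 0 \<le> f s \<and> g s \<le> 0"
  shows "hits_robustly f g S e"
proof -
  obtain s where s: "s \<in> S" "0 \<le> f s" "0 \<le> g s" using q(1) by blast
  obtain t where t: "t \<in> S" "f t \<le> 0" "0 \<le> g t" using q(2) by blast
  obtain t' where t': "t' \<in> S" "0 \<le> f t'" "g t' \<le> 0" using q(3) by blast
  consider "3 * e \<le> g s" | "3 * e \<le> f s" using box[OF s(1)] s by linarith
  then show ?thesis
  proof cases
    case 1
    show ?thesis
      by (rule hits_robustly_vertical[OF S \<open>0 < e\<close> _ _ s(1,2) 1 t']) (use box ne in blast)+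
  next
    case 2
    have "hits_robustly g f S e"
      by (rule hits_robustly_vertical[OF assms(1,3,2,4) _ _ s(1,3) 2 t(1,3,2)])
        (use box ne in blast)+
    then show ?thesis by (rule hits_robustly_swap)
  qed
qed

text \<open>If all four corners beyond the box are hit, the unshifted vertex works with room to
  spare. Otherwise reflections carry a missed corner to the upper right.\<close>

lemma hits_robustly_connected:
  fixes f g :: "'a::topological_space \<Rightarrow> real"
  assumes S: "connected S" "continuous_on S f" "continuous_on S g" and "0 < e"
    and box: "\<And>s. s \<in> S \<Longrightarrow> 3 * e \<le> \<bar>f s\<bar> \<or> 3 * e \<le> \<bar>g s\<bar>"
    and q: "\<exists>s\<in>S. 0 \<le> f s \<and> 0 \<le> g s" "\<exists>s\<in>S. f s \<le> 0 \<and> 0 \<le> g s"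
      "\<exists>s\<in>S. f s \<le> 0 \<and> g s \<le> 0" "\<exists>s\<in>S. 0 \<le> f s \<and> g s \<le> 0"
  shows "hits_robustly f g S e"
proof -
  have m: "continuous_on S (\<lambda>s. - f s)" "continuous_on S (\<lambda>s. - g s)"
    using S by (auto intro: continuous_intros)
  consider (all) "\<exists>s\<in>S. 3 * e \<le> f s \<and> 3 * e \<le> g s" "\<exists>s\<in>S. 3 * e \<le> - f s \<and> 3 * e \<le> g s"
      "\<exists>s\<in>S. 3 * e \<le> - f s \<and> 3 * e \<le> - g s" "\<exists>s\<in>S. 3 * e \<le> f s \<and> 3 * e \<le> - g s"
    | (ne) "\<And>s. s \<in> S \<Longrightarrow> f s < 3 * e \<or> g s < 3 * e"
    | (nw) "\<And>s. s \<in> S \<Longrightarrow> - f s < 3 * e \<or> g s < 3 * e"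
    | (sw) "\<And>s. s \<in> S \<Longrightarrow> - f s < 3 * e \<or> - g s < 3 * e"
    | (se) "\<And>s. s \<in> S \<Longrightarrow> f s < 3 * e \<or> - g s < 3 * e"
    using not_le by metis
  then show ?thesis
  proof cases
    case all
    then show ?thesis
      unfolding hits_robustly_def using \<open>0 < e\<close>
      by (intro exI[of _ 0] conjI) (simp_all, (elim bexE, intro bexI; simp)+)
  next
    case ne
    then show ?thesis using hits_robustly_missed_corner[OF assms(1-5)] q by blast
  next
    case nw
    have "hits_robustly (\<lambda>s. - f s) g S e"
      by (rule hits_robustly_missed_corner[OF S(1) m(1) S(3) \<open>0 < e\<close>]) (use box nw q in auto)
    then show ?thesis by (rule hits_robustly_uminus1)
  next
    case sw
    have "hits_robustly (\<lambda>s. - f s) (\<lambda>s. - g s) S e"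
      by (rule hits_robustly_missed_corner[OF S(1) m(1) m(2) \<open>0 < e\<close>]) (use box sw q in auto)
    then show ?thesis by (rule hits_robustly_uminus1[OF hits_robustly_uminus2])
  next
    case se
    have "hits_robustly f (\<lambda>s. - g s) S e"
      by (rule hits_robustly_missed_corner[OF S(1) S(2) m(2) \<open>0 < e\<close>]) (use box se q in auto)
    then show ?thesis by (rule hits_robustly_uminus2)
  qed
qed

subsection \<open>Stability of the hull\<close>

text \<open>The constant 7 comes from the case where \<open>S\<close> enters the box of half-side
  \<open>3 * e\<close> around \<open>x\<close>: at most \<open>6 * e\<close> to a point of
  \<open>S\<close> and \<open>e\<close> on to the sample. In the other case the shifted vertex
  itself is the witness, at distance at most \<open>4 * e\<close>.\<close>

lemma biconvex_hull_near:
  assumes "connected S" "compact S" "0 < e"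
    and cover: "\<And>s. s \<in> S \<Longrightarrow> \<exists>a\<in>A. dist s a \<le> e"
    and x: "x \<in> biconvex_hull \<theta> S"
  shows "\<exists>z\<in>biconvex_hull \<theta> A. dist x z \<le> 7 * e"
proof (cases "\<exists>s\<in>S. \<bar>b1 \<theta> \<bullet> (s - x)\<bar> < 3 * e \<and> \<bar>b2 \<theta> \<bullet> (s - x)\<bar> < 3 * e")
  case True
  then obtain s where s: "s \<in> S" "\<bar>b1 \<theta> \<bullet> (s - x)\<bar> < 3 * e" "\<bar>b2 \<theta> \<bullet> (s - x)\<bar> < 3 * e" by blast
  obtain a where a: "a \<in> A" "dist s a \<le> e" using cover[OF s(1)] by blast
  have "dist x s \<le> 6 * e"
    using norm_le_b1_b2[of "s - x" \<theta>] s by (simp add: dist_norm norm_minus_commute)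
  then have "dist x a \<le> 7 * e"
    using a dist_triangle[of x a s] by linarith
  then show ?thesis using a(1) subset_biconvex_hull by blast
next
  case False
  define f g where "f s = b1 \<theta> \<bullet> (s - x)" and "g s = b2 \<theta> \<bullet> (s - x)" for s
  have hit: "\<exists>s\<in>S. 0 \<le> p * f s \<and> 0 \<le> q * g s" if "\<bar>p\<bar> = 1" "\<bar>q\<bar> = 1" for p q
    using biconvex_hullD[OF \<open>compact S\<close> x that]
    by (auto simp: f_def g_def inner_diff_right right_diff_distrib)
  have "hits_robustly f g S e"
  proof (rule hits_robustly_connected[OF \<open>connected S\<close> _ _ \<open>0 < e\<close>])
    show "continuous_on S f" "continuous_on S g"
      unfolding f_def g_def by (intro continuous_intros)+
    show "3 * e \<le> \<bar>f s\<bar> \<or> 3 * e \<le> \<bar>g s\<bar>" if "s \<in> S" for s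
      using False that by (force simp: f_def g_def not_less)
    show "\<exists>s\<in>S. 0 \<le> f s \<and> 0 \<le> g s" using hit[of 1 1] by simp
    show "\<exists>s\<in>S. f s \<le> 0 \<and> 0 \<le> g s" using hit[of "- 1" 1] by simp
    show "\<exists>s\<in>S. f s \<le> 0 \<and> g s \<le> 0" using hit[of "- 1" "- 1"] by simp
    show "\<exists>s\<in>S. 0 \<le> f s \<and> g s \<le> 0" using hit[of 1 "- 1"] by simp
  qed
  then obtain \<alpha> \<beta> where ab: "\<bar>\<alpha>\<bar> \<le> 2 * e" "\<bar>\<beta>\<bar> \<le> 2 * e"
    and h: "\<exists>s\<in>S. \<alpha> + e \<le> f s \<and> \<beta> + e \<le> g s" "\<exists>s\<in>S. f s \<le> \<alpha> - e \<and> \<beta> + e \<le> g s"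
     "\<exists>s\<in>S. f s \<le> \<alpha> - e \<and> g s \<le> \<beta> - e" "\<exists>s\<in>S. \<alpha> + e \<le> f s \<and> g s \<le> \<beta> - e"
    unfolding hits_robustly_def by blast
  define z where "z = x + (\<alpha> *\<^sub>R b1 \<theta> + \<beta> *\<^sub>R b2 \<theta>)"
  have z: "b1 \<theta> \<bullet> z = b1 \<theta> \<bullet> x + \<alpha>" "b2 \<theta> \<bullet> z = b2 \<theta> \<bullet> x + \<beta>"
    unfolding z_def inner_add_right[of _ x] b1_b2_coords by simp_all
  have "dist x z \<le> 4 * e"
    using norm_le_b1_b2[of "z - x" \<theta>] ab z by (simp add: dist_norm norm_minus_commute inner_diff_right)
  moreover have "z \<in> biconvex_hull \<theta> A"
  proof (rule biconvex_hullI)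
    fix p q :: real assume pq: "\<bar>p\<bar> = 1" "\<bar>q\<bar> = 1"
    have "\<exists>s\<in>S. p * \<alpha> + e \<le> p * f s \<and> q * \<beta> + e \<le> q * g s"
    proof -
      consider "p = 1" "q = 1" | "p = - 1" "q = 1" | "p = - 1" "q = - 1" | "p = 1" "q = - 1"
        using pq by linarith
      then show ?thesis
      proof cases
        case 1
        then show ?thesis using h(1) by simp
      next
        case 2
        obtain s where "s \<in> S" "f s \<le> \<alpha> - e" "\<beta> + e \<le> g s" using h(2) by blast
        then show ?thesis using 2 by (intro bexI[of _ s]) auto
      next
        case 3
        obtain s where "s \<in> S" "f s \<le> \<alpha> - e" "g s \<le> \<beta> - e" using h(3) by blast
        then show ?thesis using 3 by (intro bexI[of _ s]) auto
      next
        case 4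
        obtain s where "s \<in> S" "\<alpha> + e \<le> f s" "g s \<le> \<beta> - e" using h(4) by blast
        then show ?thesis using 4 by (intro bexI[of _ s]) auto
      qed
    qed
    then obtain s where s: "s \<in> S" "p * \<alpha> + e \<le> p * f s" "q * \<beta> + e \<le> q * g s" by blast
    obtain a where a: "a \<in> A" "dist s a \<le> e" using cover[OF s(1)] by blast
    \<comment> \<open>Coordinates are 1-Lipschitz, so replacing \<open>s\<close> by a sample point
      costs no more than the margin \<open>e\<close>.\<close>
    have "\<bar>p * (b1 \<theta> \<bullet> s - b1 \<theta> \<bullet> a)\<bar> \<le> e" "\<bar>q * (b2 \<theta> \<bullet> s - b2 \<theta> \<bullet> a)\<bar> \<le> e"
      unfolding abs_mult pq using abs_b1_b2_diff_le[of \<theta> s a] a by simp_all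
    then show "\<exists>s\<in>A. p * (b1 \<theta> \<bullet> z) \<le> p * (b1 \<theta> \<bullet> s) \<and> q * (b2 \<theta> \<bullet> z) \<le> q * (b2 \<theta> \<bullet> s)"
      using s(2,3) by (intro bexI[OF _ a(1)])
        (auto simp: f_def g_def z inner_diff_right right_diff_distrib distrib_left)
  qed
  ultimately show ?thesis using \<open>0 < e\<close> by force
qed

text \<open>Raising both thresholds of a quadrant that misses \<open>A\<close> by \<open>e\<close>
  gives one that misses \<open>S\<close>: a point of \<open>S\<close> in it would have a sample
  point within \<open>e\<close>, still inside the original quadrant.\<close>

lemma biconvex_hull_complement_near:
  assumes "0 < e" and cover: "\<And>s. s \<in> S \<Longrightarrow> \<exists>a\<in>A. dist s a \<le> e"
    and x: "x \<notin> biconvex_hull \<theta> A"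
  shows "\<exists>z. z \<notin> biconvex_hull \<theta> S \<and> dist x z \<le> 4 * e"
proof -
  obtain p q a b where pq: "\<bar>p\<bar> = 1" "\<bar>q\<bar> = 1"
    and x: "a < p * (b1 \<theta> \<bullet> x)" "b < q * (b2 \<theta> \<bullet> x)"
    and miss: "\<And>s. s \<in> A \<Longrightarrow> \<not> (a < p * (b1 \<theta> \<bullet> s) \<and> b < q * (b2 \<theta> \<bullet> s))"
    using x unfolding mem_biconvex_hull_iff by blast
  \<comment> \<open>Each signed coordinate grows by \<open>2 * e\<close>, which clears the raised
    thresholds \<open>a + e\<close> and \<open>b + e\<close>; the total displacement is at most
    \<open>4 * e\<close>.\<close>
  define z where "z = x + ((2 * e * p) *\<^sub>R b1 \<theta> + (2 * e * q) *\<^sub>R b2 \<theta>)"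
  have sq: "p * p = 1" "q * q = 1"
    using pq by (metis abs_mult_self_eq mult_1)+
  have z: "b1 \<theta> \<bullet> z = b1 \<theta> \<bullet> x + 2 * e * p" "b2 \<theta> \<bullet> z = b2 \<theta> \<bullet> x + 2 * e * q"
    unfolding z_def inner_add_right[of _ x] b1_b2_coords by simp_all
  have pz: "p * (b1 \<theta> \<bullet> z) = p * (b1 \<theta> \<bullet> x) + 2 * e" "q * (b2 \<theta> \<bullet> z) = q * (b2 \<theta> \<bullet> x) + 2 * e"
    unfolding z using sq by (simp_all add: distrib_left mult.left_commute)
  have "dist x z \<le> 4 * e"
    using norm_le_b1_b2[of "z - x" \<theta>] \<open>0 < e\<close> z pq
    by (simp add: dist_norm norm_minus_commute inner_diff_right abs_mult)
  moreover have "z \<notin> biconvex_hull \<theta> S"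
  proof
    assume "z \<in> biconvex_hull \<theta> S"
    moreover have "a + e < p * (b1 \<theta> \<bullet> z)" "b + e < q * (b2 \<theta> \<bullet> z)"
      unfolding pz using x \<open>0 < e\<close> by linarith+
    ultimately obtain s where s: "s \<in> S" "a + e < p * (b1 \<theta> \<bullet> s)" "b + e < q * (b2 \<theta> \<bullet> s)"
      unfolding mem_biconvex_hull_iff using pq by blast
    obtain c where c: "c \<in> A" "dist s c \<le> e" using cover[OF s(1)] by blast
    have "\<bar>p * (b1 \<theta> \<bullet> s - b1 \<theta> \<bullet> c)\<bar> \<le> e" "\<bar>q * (b2 \<theta> \<bullet> s - b2 \<theta> \<bullet> c)\<bar> \<le> e"
      unfolding abs_mult pq using abs_b1_b2_diff_le[of \<theta> s c] c by simp_all
    then have "a < p * (b1 \<theta> \<bullet> c)" "b < q * (b2 \<theta> \<bullet> c)"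
      using s unfolding right_diff_distrib by linarith+
    then show False using miss[OF c(1)] by blast
  qed
  ultimately show ?thesis by blast
qed

text \<open>A segment from inside to outside is connected and so crosses the frontier; by convexity
  it stays in the ball around \<open>x\<close>.\<close>

lemma frontier_near:
  fixes B :: "'a::real_normed_vector set"
  assumes "b \<in> B" "z \<notin> B" "dist x b \<le> r" "dist x z \<le> r"
  shows "\<exists>w\<in>frontier B. dist x w \<le> r"
proof -
  have "closed_segment b z \<inter> frontier B \<noteq> {}"
    using assms by (intro connected_Int_frontier) auto
  moreover have "closed_segment b z \<subseteq> cball x r"
    using assms by (intro closed_segment_subset) auto
  ultimately show ?thesis by auto
qed

text \<open>Each part feeds \<open>frontier_near\<close> with a point inside and a point outside the
  hull concerned. In the first, the outside point is inherited by the smaller hull; in the second,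
  \<open>x\<close> itself is inside the larger hull and the outside point is at distance at most
  \<open>e + 4 * e\<close>; in the third, \<open>x\<close> is again the inside point.\<close>

lemma frontier_biconvex_hull_near:
  assumes "connected S" "compact S" "0 < e"
    and cover: "\<And>s. s \<in> S \<Longrightarrow> \<exists>a\<in>A. dist s a \<le> e" and "A \<subseteq> S"
  shows "x \<in> frontier (biconvex_hull \<theta> S) \<Longrightarrow> \<exists>w\<in>frontier (biconvex_hull \<theta> A). dist x w \<le> 7 * e"
    and "x \<in> frontier (biconvex_hull \<theta> A) \<Longrightarrow> \<exists>w\<in>frontier (biconvex_hull \<theta> S). dist x w \<le> 7 * e"
    and "x \<in> biconvex_hull \<theta> S - biconvex_hull \<theta> A \<Longrightarrow> \<exists>w\<in>frontier (biconvex_hull \<theta> S). dist x w \<le> 4 * e"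
proof -
  have sub: "biconvex_hull \<theta> A \<subseteq> biconvex_hull \<theta> S"
    using \<open>A \<subseteq> S\<close> by (rule biconvex_hull_mono)
  have fr: "x \<in> C" "\<exists>z. z \<notin> C \<and> dist x z < e" if "x \<in> frontier C" "closed C" for C
    using that frontier_subset_closed frontier_straddle[of x C] \<open>0 < e\<close> by blast+
  show "\<exists>w\<in>frontier (biconvex_hull \<theta> A). dist x w \<le> 7 * e" if x: "x \<in> frontier (biconvex_hull \<theta> S)"
  proof -
    obtain z where z: "z \<notin> biconvex_hull \<theta> S" "dist x z < e" using fr(2)[OF x closed_biconvex_hull] by blast
    obtain b where b: "b \<in> biconvex_hull \<theta> A" "dist x b \<le> 7 * e"
      using biconvex_hull_near[OF assms(1-4) fr(1)[OF x closed_biconvex_hull]] by blast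
    show ?thesis
      using z sub \<open>0 < e\<close> by (intro frontier_near[OF b(1) _ b(2)]) auto
  qed
  show "\<exists>w\<in>frontier (biconvex_hull \<theta> S). dist x w \<le> 7 * e" if x: "x \<in> frontier (biconvex_hull \<theta> A)"
  proof -
    obtain z where z: "z \<notin> biconvex_hull \<theta> A" "dist x z < e" using fr(2)[OF x closed_biconvex_hull] by blast
    obtain z' where z': "z' \<notin> biconvex_hull \<theta> S" "dist z z' \<le> 4 * e"
      using biconvex_hull_complement_near[OF \<open>0 < e\<close> cover z(1)] by blast
    have "x \<in> biconvex_hull \<theta> S" using fr(1)[OF x closed_biconvex_hull] sub by blast
    then show ?thesis
      using z(2) z' \<open>0 < e\<close> dist_triangle[of x z' z] by (intro frontier_near[of x _ z']) auto
  qed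
  show "\<exists>w\<in>frontier (biconvex_hull \<theta> S). dist x w \<le> 4 * e" if x: "x \<in> biconvex_hull \<theta> S - biconvex_hull \<theta> A"
  proof -
    obtain z where z: "z \<notin> biconvex_hull \<theta> S" "dist x z \<le> 4 * e"
      using biconvex_hull_complement_near[OF \<open>0 < e\<close> cover] x by blast
    then show ?thesis
      using x \<open>0 < e\<close> by (intro frontier_near[of x _ z]) auto
  qed
qed

section \<open>From density of the sample to the Hausdorff distances\<close>

lemma hausdorff_distance_bounds:
  assumes "A \<noteq> {}" "C \<noteq> {}"
    and "\<And>a. a \<in> A \<Longrightarrow> \<exists>c\<in>C. dist a c \<le> k" "\<And>c. c \<in> C \<Longrightarrow> \<exists>a\<in>A. dist c a \<le> k"
  shows "0 \<le> hausdorff_distance A C \<and> hausdorff_distance A C \<le> k"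
proof -
  have le: "infdist a C \<le> k" if "a \<in> A" for a
    using assms(3)[OF that] infdist_le order_trans by blast
  have "infdist c A \<le> k" if "c \<in> C" for c
    using assms(4)[OF that] infdist_le order_trans by blast
  then have "(SUP a\<in>A. infdist a C) \<le> k" "(SUP c\<in>C. infdist c A) \<le> k"
    using le assms(1,2) by (auto intro: cSUP_least)
  moreover have "0 \<le> (SUP a\<in>A. infdist a C)"
  proof -
    obtain a where "a \<in> A" using assms(1) by blast
    have "0 \<le> infdist a C" by (rule infdist_nonneg)
    \<comment> \<open>In a conditionally complete order a member is below the supremum only for a
      set bounded above; the bound is \<open>k\<close>.\<close>
    also have "\<dots> \<le> (SUP a\<in>A. infdist a C)"
      using \<open>a \<in> A\<close> le by (intro cSUP_upper) (auto intro!: bdd_aboveI2[of _ _ k])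
    finally show ?thesis .
  qed
  ultimately show ?thesis by (simp add: hausdorff_distance_def)
qed

text \<open>A splitting of \<open>S\<close> into disjoint closed pieces would split its frontier.
  Each piece is bounded and non-empty, so it has a frontier point; and a point of a piece interior
  to \<open>S\<close> is interior to that piece, so these frontier points lie in
  \<open>frontier S\<close>.\<close>

lemma connected_if_connected_frontier:
  fixes S :: "'a::{real_normed_vector, perfect_space} set"
  assumes "closed S" "bounded S" "connected (frontier S)"
  shows "connected S"
proof (rule ccontr)
  assume "\<not> connected S"
  then obtain U V where UV: "closed U" "closed V" "U \<noteq> {}" "V \<noteq> {}" "U \<union> V = S" "U \<inter> V = {}"
    using connected_closed_set[OF \<open>closed S\<close>] by blast
  have part: "frontier U \<noteq> {} \<and> frontier U \<subseteq> frontier S \<inter> U"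
    if "closed U" "closed V" "U \<noteq> {}" "U \<union> V = S" "U \<inter> V = {}" for U V
  proof
    have "U \<noteq> UNIV" using that \<open>bounded S\<close> not_bounded_UNIV by auto
    then show "frontier U \<noteq> {}" using that by (simp add: frontier_eq_empty)
    have "interior S \<inter> U \<subseteq> interior U"
    proof -
      have "interior S \<inter> U = interior S \<inter> - V"
        using that interior_subset[of S] by blast
      then have "open (interior S \<inter> U)" using that by auto
      then show ?thesis by (simp add: interior_maximal)
    qed
    then show "frontier U \<subseteq> frontier S \<inter> U"
      using that \<open>closed S\<close> frontier_subset_closed[of U] by (auto simp: frontier_def)
  qed
  have "frontier U \<noteq> {}" "frontier U \<subseteq> frontier S \<inter> U" "frontier V \<noteq> {}" "frontier V \<subseteq> frontier S \<inter> V"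
    using part[of U V] part[of V U] UV by (auto simp: Un_commute Int_commute)
  moreover have "frontier S \<subseteq> U \<union> V"
    using UV \<open>closed S\<close> frontier_subset_closed by blast
  ultimately show False
    using assms(3) UV(1,2,6) unfolding connected_closed by blast
qed

lemma frontier_nonempty_of_compact:
  fixes B :: "'a::{real_normed_vector, perfect_space} set"
  assumes "compact B" "B \<noteq> {}"
  shows "frontier B \<noteq> {}"
  using assms(2) compact_imp_bounded[OF assms(1)] not_bounded_UNIV by (auto simp: frontier_eq_empty)

lemma hausdorff_distance_biconvex_hull_bigo:
  assumes S: "connected S" "compact S" "S \<noteq> {}" and A: "\<And>n. A n \<subseteq> S"
    and e: "\<forall>\<^sub>F n in sequentially. 0 < e n"
    and cover: "\<forall>\<^sub>F n in sequentially. \<forall>s\<in>S. \<exists>a\<in>A n. dist s a \<le> e n"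
  shows "(\<lambda>n. hausdorff_distance (biconvex_hull \<theta> (A n)) (biconvex_hull \<theta> S)) \<in> O(e)"
    and "(\<lambda>n. hausdorff_distance (frontier (biconvex_hull \<theta> S)) (frontier (biconvex_hull \<theta> (A n)))) \<in> O(e)"
proof -
  have both: "\<forall>\<^sub>F n in sequentially.
      hausdorff_distance (biconvex_hull \<theta> (A n)) (biconvex_hull \<theta> S) \<in> {0..7 * e n} \<and>
      hausdorff_distance (frontier (biconvex_hull \<theta> S)) (frontier (biconvex_hull \<theta> (A n))) \<in> {0..7 * e n}"
    using e cover
  proof eventually_elim
    case (elim n)
    then have cov: "\<And>s. s \<in> S \<Longrightarrow> \<exists>a\<in>A n. dist s a \<le> e n" by blast
    have ne: "biconvex_hull \<theta> (A n) \<noteq> {}" "biconvex_hull \<theta> S \<noteq> {}"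
      using cov S(3) subset_biconvex_hull[of "A n" \<theta>] subset_biconvex_hull[of S \<theta>] by blast+
    have sub: "biconvex_hull \<theta> (A n) \<subseteq> biconvex_hull \<theta> S"
      using A by (rule biconvex_hull_mono)
    have comp: "compact (biconvex_hull \<theta> S)" using S(2) by (rule compact_biconvex_hull)
    \<comment> \<open>Obtained as a closed subset of the compact hull of \<open>S\<close>, with no
      compactness of \<open>A n\<close> at hand.\<close>
    have comp': "compact (biconvex_hull \<theta> (A n))"
      using closed_biconvex_hull sub comp compact_Int_closed[of "biconvex_hull \<theta> S" "biconvex_hull \<theta> (A n)"]
      by (simp add: Int_absorb1)
    have "0 \<le> hausdorff_distance (biconvex_hull \<theta> (A n)) (biconvex_hull \<theta> S) \<and>
        hausdorff_distance (biconvex_hull \<theta> (A n)) (biconvex_hull \<theta> S) \<le> 7 * e n"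
    proof (rule hausdorff_distance_bounds[OF ne])
      show "\<exists>c\<in>biconvex_hull \<theta> S. dist a c \<le> 7 * e n" if "a \<in> biconvex_hull \<theta> (A n)" for a
        using that sub elim(1) by (intro bexI[of _ a]) auto
      show "\<exists>a\<in>biconvex_hull \<theta> (A n). dist c a \<le> 7 * e n" if "c \<in> biconvex_hull \<theta> S" for c
        using S(1,2) elim(1) cov that by (rule biconvex_hull_near)
    qed
    moreover have "0 \<le> hausdorff_distance (frontier (biconvex_hull \<theta> S)) (frontier (biconvex_hull \<theta> (A n))) \<and>
        hausdorff_distance (frontier (biconvex_hull \<theta> S)) (frontier (biconvex_hull \<theta> (A n))) \<le> 7 * e n"
      using frontier_biconvex_hull_near(1,2)[OF S(1,2) elim(1) cov A]
      by (intro hausdorff_distance_bounds frontier_nonempty_of_compact comp comp' ne)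
    ultimately show ?case by simp
  qed
  show "(\<lambda>n. hausdorff_distance (biconvex_hull \<theta> (A n)) (biconvex_hull \<theta> S)) \<in> O(e)"
    by (rule bigoI[of _ 7], rule eventually_mono[OF eventually_conj[OF e both]]) auto
  show "(\<lambda>n. hausdorff_distance (frontier (biconvex_hull \<theta> S)) (frontier (biconvex_hull \<theta> (A n)))) \<in> O(e)"
    by (rule bigoI[of _ 7], rule eventually_mono[OF eventually_conj[OF e both]]) auto
qed

section \<open>The measure of the symmetric difference via the Minkowski content\<close>

lemma compact_UN_cball:
  fixes K :: "'a::euclidean_space set"
  assumes "compact K"
  shows "compact (\<Union>t\<in>K. cball t r)"
proof -
  have "(\<Union>t\<in>K. cball t r) = {x + y |x y. x \<in> K \<and> y \<in> cball 0 r}"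
  proof (intro equalityI subsetI)
    fix z assume "z \<in> (\<Union>t\<in>K. cball t r)"
    then obtain t where "t \<in> K" "dist t z \<le> r" by auto
    then have "z = t + (z - t)" "z - t \<in> cball 0 r"
      by (simp_all add: dist_norm norm_minus_commute)
    then show "z \<in> {x + y |x y. x \<in> K \<and> y \<in> cball 0 r}" using \<open>t \<in> K\<close> by blast
  next
    fix z assume "z \<in> {x + y |x y. x \<in> K \<and> y \<in> cball 0 r}"
    then obtain x y where "z = x + y" "x \<in> K" "norm y \<le> r" by auto
    then show "z \<in> (\<Union>t\<in>K. cball t r)"
      by (intro UN_I[of x]) (simp_all add: dist_norm)
  qed
  then show ?thesis
    using compact_sums[OF assms compact_cball, of 0 r] by (simp only:)
qed

text \<open>The part of the hull that the sample loses lies in the tube of radius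
  \<open>4 * e n\<close> around the frontier, and finite content makes the measure of that tube
  linear in its radius.\<close>

lemma measure_distance_biconvex_hull_bigo:
  assumes S: "connected S" "compact S" and A: "\<And>n. A n \<subseteq> S"
    and e: "\<forall>\<^sub>F n in sequentially. 0 < e n" "e \<longlonglongrightarrow> 0"
    and cover: "\<forall>\<^sub>F n in sequentially. \<forall>s\<in>S. \<exists>a\<in>A n. dist s a \<le> e n"
    and L: "has_minkowski_content_frontier (biconvex_hull \<theta> S) L"
  shows "(\<lambda>n. measure_distance (biconvex_hull \<theta> (A n)) (biconvex_hull \<theta> S)) \<in> O(e)"
proof -
  define N where "N r = (\<Union>t\<in>frontier (biconvex_hull \<theta> S). cball t r)" for r
  \<comment> \<open>Any number above the limit serves; \<open>L + 1\<close> at radius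
    \<open>4 * e n\<close> yields the constant \<open>8 * (L + 1)\<close> below.\<close>
  have "\<forall>\<^sub>F r in at_right 0. measure lebesgue (N r) / (2 * r) < L + 1"
    using L unfolding has_minkowski_content_frontier_def N_def by (rule order_tendstoD) simp
  moreover have "filterlim (\<lambda>n. 4 * e n) (at_right 0) sequentially"
    using e tendsto_mult_right_zero[OF e(2), of 4] by (intro tendsto_imp_filterlim_at_right) auto
  ultimately have "\<forall>\<^sub>F n in sequentially. measure lebesgue (N (4 * e n)) / (2 * (4 * e n)) < L + 1"
    by (rule eventually_compose_filterlim)
  with e(1) cover have "\<forall>\<^sub>F n in sequentially.
      norm (measure_distance (biconvex_hull \<theta> (A n)) (biconvex_hull \<theta> S)) \<le> 8 * (L + 1) * norm (e n)"
  proof eventually_elim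
    case (elim n)
    then have cov: "\<And>s. s \<in> S \<Longrightarrow> \<exists>a\<in>A n. dist s a \<le> e n" by blast
    have comp: "compact (biconvex_hull \<theta> S)" using S(2) by (rule compact_biconvex_hull)
    have "sym_diff (biconvex_hull \<theta> (A n)) (biconvex_hull \<theta> S) = biconvex_hull \<theta> S - biconvex_hull \<theta> (A n)"
      using biconvex_hull_mono[OF A, of \<theta> n] by blast
    moreover have "biconvex_hull \<theta> S - biconvex_hull \<theta> (A n) \<subseteq> N (4 * e n)"
      using frontier_biconvex_hull_near(3)[OF S elim(1) cov A]
      unfolding N_def by (fastforce simp: dist_commute)
    \<comment> \<open>Compactness gives the tube finite measure, without which
      \<open>measure\<close> need not be monotone.\<close>
    moreover have "N (4 * e n) \<in> lmeasurable"
      unfolding N_def using comp by (intro lmeasurable_compact compact_UN_cball compact_frontier)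
    moreover have "biconvex_hull \<theta> S - biconvex_hull \<theta> (A n) \<in> sets lebesgue"
      using closed_biconvex_hull by (intro sets.Diff) auto
    ultimately have "measure_distance (biconvex_hull \<theta> (A n)) (biconvex_hull \<theta> S) \<le> measure lebesgue (N (4 * e n))"
      unfolding measure_distance_def by (simp add: measure_mono_fmeasurable)
    also have "\<dots> \<le> 8 * (L + 1) * e n"
      using elim(1,3) by (simp add: divide_less_eq mult_ac)
    finally show ?case
      using elim(1) by (simp add: measure_distance_def)
  qed
  then show ?thesis by (rule bigoI)
qed

subsection \<open>Covering the support by the sample\<close>

lemma (in prob_space) disjoint_events_card_le:
  fixes S :: "'a set" and B :: "'b \<Rightarrow> 'a set"
  assumes "finite F" "disjoint_family_on B F" "\<And>x. x \<in> F \<Longrightarrow> B x \<in> events"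
    and "\<And>x. x \<in> F \<Longrightarrow> m \<le> prob (B x)"
  shows "real (card F) * m \<le> 1"
proof -
  have "real (card F) * m \<le> (\<Sum>x\<in>F. prob (B x))"
    using assms(4) by (rule sum_bounded_below)
  also have "\<dots> = prob (\<Union>x\<in>F. B x)"
    using assms(1-3) by (intro finite_measure_finite_Union[symmetric]) auto
  finally show ?thesis
    using prob_le_1 order_trans by blast
qed

text \<open>A \<open>2 * e\<close>-separated subset of \<open>S\<close> carries disjoint balls of
  mass at least \<open>m\<close>, so it has at most \<open>1 / m\<close> points. One of greatest
  cardinality exists, and it is a \<open>2 * e\<close>-net because no point can be added to
  it.\<close>

lemma finite_net_of_ball_mass:
  fixes P :: "'a::metric_space measure"
  assumes "prob_space P" "sets P = sets borel" and "0 < m"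
    and mass: "\<And>x. x \<in> S \<Longrightarrow> m \<le> measure P (cball x e)"
  shows "\<exists>T. finite T \<and> T \<subseteq> S \<and> real (card T) * m \<le> 1 \<and> (\<forall>s\<in>S. \<exists>t\<in>T. dist t s \<le> 2 * e)"
proof -
  interpret prob_space P by fact
  define sep where "sep T \<longleftrightarrow> finite T \<and> T \<subseteq> S \<and> (\<forall>x\<in>T. \<forall>y\<in>T. x \<noteq> y \<longrightarrow> 2 * e < dist x y)" for T
  have card: "real (card T) * m \<le> 1" if "sep T" for T
  proof (rule disjoint_events_card_le[where B = "\<lambda>x. cball x e"])
    show "disjoint_family_on (\<lambda>x. cball x e) T"
      unfolding disjoint_family_on_def
    proof (intro ballI impI)
      fix x y assume "x \<in> T" "y \<in> T" "x \<noteq> y"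
      then have "2 * e < dist x y" using that by (auto simp: sep_def)
      then show "cball x e \<inter> cball y e = {}"
        by (smt (verit) disjoint_iff dist_commute dist_triangle mem_cball)
    qed
  qed (use that mass assms(2) in \<open>auto simp: sep_def\<close>)
  have "\<exists>T. sep T \<and> (\<forall>T'. sep T' \<longrightarrow> card T' \<le> card T)"
  proof (rule Lattices_Big.ex_has_greatest_nat[of sep "{}" card "Suc (nat \<lfloor>1 / m\<rfloor>)"])
    show "sep {}" by (simp add: sep_def)
    show "\<forall>T. sep T \<longrightarrow> card T < Suc (nat \<lfloor>1 / m\<rfloor>)"
      using card \<open>0 < m\<close> by (auto simp: less_Suc_eq_le le_nat_floor pos_le_divide_eq)
  qed
  then obtain T where T: "sep T" and max: "\<And>T'. sep T' \<Longrightarrow> card T' \<le> card T" by blast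
  have "\<exists>t\<in>T. dist t s \<le> 2 * e" if "s \<in> S" for s
  proof (rule ccontr)
    assume "\<not> ?thesis"
    then have far: "\<And>t. t \<in> T \<Longrightarrow> 2 * e < dist t s" by force
    show False
    proof (cases "s \<in> T")
      case True
      \<comment> \<open>A negative radius would make the ball empty, against its positive
        mass.\<close>
      then have "e < 0" using far[OF True] by simp
      then show False using mass[OF that] \<open>0 < m\<close> by simp
    next
      case False
      have "sep (insert s T)"
        using T far that by (auto simp: sep_def dist_commute)
      then show False using max[of "insert s T"] False T by (simp add: sep_def)
    qed
  qed
  then show ?thesis using T card[OF T] by (auto simp: sep_def)
qed

lemma (in prob_space) iid_avoid_prob:
  assumes "indep_vars (\<lambda>_. N) X {1..}" "\<And>i. i \<ge> 1 \<Longrightarrow> distr M N (X i) = P"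
    and "B \<in> sets N" "1 \<le> n"
  shows "prob (\<Inter>i\<in>{1..n}. X i -` (space N - B) \<inter> space M) = measure P (space N - B) ^ n"
proof -
  have rv: "X i \<in> measurable M N" if "1 \<le> i" for i
    using assms(1) that by (auto simp: indep_vars_def)
  have "prob (\<Inter>i\<in>{1..n}. X i -` (space N - B) \<inter> space M) =
      (\<Prod>i\<in>{1..n}. prob (X i -` (space N - B) \<inter> space M))"
    using assms by (intro indep_varsD[of "\<lambda>_. N" X "{1..}"]) auto
  also have "\<dots> = (\<Prod>i\<in>{1..n}. measure P (space N - B))"
  proof (rule prod.cong)
    fix i assume "i \<in> {1..n}"
    then show "prob (X i -` (space N - B) \<inter> space M) = measure P (space N - B)"
      using measure_distr[OF rv[of i], of "space N - B"] assms by auto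
  qed simp
  finally show ?thesis by simp
qed

text \<open>By independence one ball is missed by all \<open>n\<close> points with probability at
  most \<open>(1 - m) ^ n\<close>, which is at most \<open>exp (- n * m)\<close>; a union bound over
  at most \<open>1 / m\<close> centres follows.\<close>

lemma (in prob_space) iid_ball_miss_prob:
  fixes X :: "nat \<Rightarrow> 'a \<Rightarrow> 'b::metric_space"
  assumes X: "indep_vars (\<lambda>_. borel) X {1..}" "\<And>i. i \<ge> 1 \<Longrightarrow> distr M borel (X i) = P"
    and "finite T" "real (card T) * m \<le> 1" "0 < m" "1 \<le> n"
    and mass: "\<And>x. x \<in> T \<Longrightarrow> m \<le> measure P (cball x e)"
  shows "{\<omega> \<in> space M. \<exists>t\<in>T. \<forall>i\<in>{1..n}. e < dist t (X i \<omega>)} \<in> events"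
    and "prob {\<omega> \<in> space M. \<exists>t\<in>T. \<forall>i\<in>{1..n}. e < dist t (X i \<omega>)} \<le> exp (- real n * m) / m"
proof -
  have rv: "X i \<in> borel_measurable M" if "1 \<le> i" for i
    using X(1) that by (auto simp: indep_vars_def)
  interpret P: prob_space P
    using X(2)[of 1] prob_space_distr[OF rv[of 1]] by simp
  have sP: "sets P = sets borel" "space P = UNIV"
    using X(2)[of 1] by auto
  define E where "E t = (\<Inter>i\<in>{1..n}. X i -` (space borel - cball t e) \<inter> space M)" for t
  have E: "E t \<in> events" for t
    unfolding E_def using \<open>1 \<le> n\<close> rv by (intro sets.finite_INT) (auto intro!: measurable_sets)
  have eq: "{\<omega> \<in> space M. \<exists>t\<in>T. \<forall>i\<in>{1..n}. e < dist t (X i \<omega>)} = (\<Union>t\<in>T. E t)"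
    using \<open>1 \<le> n\<close> by (force simp: E_def not_le)
  show "{\<omega> \<in> space M. \<exists>t\<in>T. \<forall>i\<in>{1..n}. e < dist t (X i \<omega>)} \<in> events"
    unfolding eq using \<open>finite T\<close> E by auto
  have prob_E: "prob (E t) \<le> exp (- real n * m)" if "t \<in> T" for t
  proof -
    have "prob (E t) = measure P (space borel - cball t e) ^ n"
      unfolding E_def using X \<open>1 \<le> n\<close> by (intro iid_avoid_prob) auto
    also have "measure P (space borel - cball t e) = 1 - measure P (cball t e)"
      using P.prob_compl[of "cball t e"] sP by simp
    also have "(1 - measure P (cball t e)) ^ n \<le> exp (- m) ^ n"
    proof (rule power_mono)
      show "1 - measure P (cball t e) \<le> exp (- m)"
        using mass[OF that] exp_ge_add_one_self[of "- m"] by linarith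
    qed simp
    finally show ?thesis by (simp add: exp_of_nat_mult flip: exp_of_nat_mult)
  qed
  have "prob (\<Union>t\<in>T. E t) \<le> (\<Sum>t\<in>T. prob (E t))"
    using \<open>finite T\<close> E by (intro finite_measure_subadditive_finite) auto
  also have "\<dots> \<le> real (card T) * exp (- real n * m)"
    using prob_E by (rule sum_bounded_above)
  also have "\<dots> \<le> 1 / m * exp (- real n * m)"
    using assms by (intro mult_right_mono) (auto simp: pos_le_divide_eq)
  finally show "prob {\<omega> \<in> space M. \<exists>t\<in>T. \<forall>i\<in>{1..n}. e < dist t (X i \<omega>)} \<le> exp (- real n * m) / m"
    unfolding eq by simp
qed

text \<open>For each \<open>n\<close> a fresh \<open>2 * e n\<close>-net of \<open>S\<close> is
  taken. By Borel-Cantelli, almost surely for all large \<open>n\<close> every net point has a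
  sample point within \<open>e n\<close>, and the triangle inequality gives
  \<open>3 * e n\<close>.\<close>

lemma (in prob_space) iid_sample_covers:
  fixes X :: "nat \<Rightarrow> 'a \<Rightarrow> 'b::metric_space"
  assumes X: "indep_vars (\<lambda>_. borel) X {1..}" "\<And>i. i \<ge> 1 \<Longrightarrow> distr M borel (X i) = P"
    and "0 < r" "0 < k"
    and mass: "\<And>x e. x \<in> S \<Longrightarrow> 0 < e \<Longrightarrow> e \<le> r \<Longrightarrow> k * e\<^sup>2 \<le> measure P (cball x e)"
  shows "AE \<omega> in M. \<forall>\<^sub>F n in sequentially. \<forall>s\<in>S. \<exists>i\<in>{1..n}.
           dist s (X i \<omega>) \<le> 3 * (sqrt (3 / k) * sqrt (ln (real n) / real n))"
proof -
  have rv: "X i \<in> borel_measurable M" if "1 \<le> i" for i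
    using X(1) that by (auto simp: indep_vars_def)
  interpret P: prob_space P
    using X(2)[of 1] prob_space_distr[OF rv[of 1]] by simp
  have sP: "sets P = sets borel"
    using X(2)[of 1] by auto
  \<comment> \<open>The constant 3 makes the failure probability \<open>exp (- n * m n) / m n\<close> of order at most \<open>1 / n\<^sup>2\<close>.\<close>
  define e where "e n = sqrt (3 / k) * sqrt (ln (real n) / real n)" for n :: nat
  define m where "m n = 3 * ln (real n) / real n" for n :: nat
  have "e \<longlonglongrightarrow> 0"
    unfolding e_def by real_asymp
  then have "\<forall>\<^sub>F n in sequentially. e n < r"
    using \<open>0 < r\<close> by (rule order_tendstoD)
  then have "\<forall>\<^sub>F n in sequentially. e n < r \<and> 3 \<le> n"
    using eventually_ge_at_top by (rule eventually_conj)
  then obtain N where N: "\<And>n. N \<le> n \<Longrightarrow> e n < r \<and> 3 \<le> n"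
    unfolding eventually_sequentially by blast
  \<comment> \<open>The threshold 3 is used because \<open>exp 1 \<le> 3\<close>.\<close>
  have ln3: "1 \<le> ln (real n)" if "3 \<le> n" for n :: nat
    using that exp_le by (subst ln_ge_iff) auto
  have pos: "0 < e n" "0 < m n" "k * (e n)\<^sup>2 = m n" if "3 \<le> n" for n
    using ln3[OF that] that \<open>0 < k\<close> by (auto simp: e_def m_def power_mult_distrib)
  have mass': "m n \<le> measure P (cball x (e n))" if "x \<in> S" "N \<le> n" for x n
    using mass[OF that(1) pos(1), of n] pos(3)[of n] N[OF that(2)] by simp
  have "\<exists>T. finite T \<and> T \<subseteq> S \<and> (N \<le> n \<longrightarrow> real (card T) * m n \<le> 1 \<and>
      (\<forall>s\<in>S. \<exists>t\<in>T. dist t s \<le> 2 * e n))" for n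
  proof (cases "N \<le> n")
    case True
    then show ?thesis
      using finite_net_of_ball_mass[OF P.prob_space_axioms sP pos(2) mass', of n] N[of n] by auto
  qed (auto intro: exI[of _ "{}"])
  then obtain T where T: "\<And>n. finite (T n)" "\<And>n. T n \<subseteq> S"
    "\<And>n. N \<le> n \<Longrightarrow> real (card (T n)) * m n \<le> 1"
    "\<And>n s. N \<le> n \<Longrightarrow> s \<in> S \<Longrightarrow> \<exists>t\<in>T n. dist t s \<le> 2 * e n"
    by metis
  \<comment> \<open>The empty default makes \<open>E n\<close> an event for every \<open>n\<close>,
    as Borel-Cantelli asks, and does not affect the tail.\<close>
  define E where "E n = (if N \<le> n then {\<omega> \<in> space M. \<exists>t\<in>T n. \<forall>i\<in>{1..n}. e n < dist t (X i \<omega>)} else {})" for n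
  have miss: "E n \<in> events" "prob (E n) \<le> exp (- real n * m n) / m n" if "N \<le> n" for n
  proof -
    have "x \<in> T n \<Longrightarrow> m n \<le> measure P (cball x (e n))" for x
      using mass'[OF _ that] T(2)[of n] by blast
    note * = iid_ball_miss_prob[OF X T(1)[of n] T(3)[OF that] pos(2) _ this]
    show "E n \<in> events" "prob (E n) \<le> exp (- real n * m n) / m n"
      using * N[OF that] that by (auto simp: E_def)
  qed
  have bound: "prob (E n) \<le> 1 / real n ^ 2" if "N \<le> n" for n
  proof -
    have n: "3 \<le> n" using N that by blast
    \<comment> \<open>The exponential is the power \<open>1 / n ^ 3\<close>; the net size bound
      \<open>1 / m n\<close> costs at most one factor \<open>n\<close>, leaving a summable
      \<open>1 / n ^ 2\<close>.\<close>
    have "exp (- real n * m n) / m n = (1 / real n ^ 3) * (real n / (3 * ln (real n)))"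
    proof -
      have "exp (- real n * m n) = exp (- (3 * ln (real n)))"
        using n by (simp add: m_def)
      also have "\<dots> = 1 / exp (ln (real n)) ^ 3"
        by (simp add: exp_minus field_simps flip: exp_of_nat_mult)
      finally show ?thesis
        using n by (simp add: m_def)
    qed
    also have "\<dots> \<le> (1 / real n ^ 3) * real n"
      using ln3[OF n] n by (intro mult_left_mono) (auto simp: divide_le_eq)
    also have "\<dots> = 1 / real n ^ 2"
      using n by (simp add: power2_eq_square power3_eq_cube)
    finally show ?thesis using miss(2)[OF that] by linarith
  qed
  have "summable (\<lambda>n. prob (E n))"
  proof (rule summable_comparison_test_ev)
    show "\<forall>\<^sub>F n in sequentially. norm (prob (E n)) \<le> 1 / real n ^ 2"
      using bound by (auto simp: eventually_sequentially)
    show "summable (\<lambda>n. 1 / real n ^ 2)"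
      using inverse_power_summable[of 2, where 'a=real] by (simp add: inverse_eq_divide)
  qed
  moreover have "E n \<in> events" for n
    using miss(1) by (cases "N \<le> n") (auto simp: E_def)
  ultimately have "AE \<omega> in M. \<forall>\<^sub>F n in sequentially. \<omega> \<in> space M - E n"
    by (intro borel_cantelli_AE1) (auto simp: emeasure_eq_measure)
  then show ?thesis
  proof (rule AE_mp, intro AE_I2 impI)
    fix \<omega> assume "\<omega> \<in> space M" "\<forall>\<^sub>F n in sequentially. \<omega> \<in> space M - E n"
    from this(2) eventually_ge_at_top[of N]
    show "\<forall>\<^sub>F n in sequentially. \<forall>s\<in>S. \<exists>i\<in>{1..n}.
           dist s (X i \<omega>) \<le> 3 * (sqrt (3 / k) * sqrt (ln (real n) / real n))"
    proof eventually_elim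
      case (elim n)
      show ?case
      proof
        fix s assume "s \<in> S"
        then obtain t where t: "t \<in> T n" "dist t s \<le> 2 * e n"
          using T(4) elim by blast
        obtain i where i: "i \<in> {1..n}" "dist t (X i \<omega>) \<le> e n"
          using elim t(1) by (auto simp: E_def not_less)
        have "dist s (X i \<omega>) \<le> dist s t + dist t (X i \<omega>)"
          by (rule dist_triangle)
        also have "\<dots> \<le> 3 * e n"
          using t i by (simp add: dist_commute)
        finally show "\<exists>i\<in>{1..n}. dist s (X i \<omega>) \<le> 3 * (sqrt (3 / k) * sqrt (ln (real n) / real n))"
          using i unfolding e_def by blast
      qed
    qed
  qed
qed

text \<open>The volume of a ball is \<open>unit_ball_vol\<close> times a power of its radius, so
  \<open>k\<close> is \<open>\<delta>\<close> times that constant. In the plane the power is 2,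
  which is the source of the square root in the rate.\<close>

lemma standard_wrt_ball_mass:
  fixes S :: "'a::euclidean_space set"
  assumes "standard_wrt S \<nu>" "prob_space \<nu>" "sets \<nu> = sets borel"
  obtains r k where "0 < r" "0 < k"
    "\<And>x e. x \<in> S \<Longrightarrow> 0 < e \<Longrightarrow> e \<le> r \<Longrightarrow> k * e ^ DIM('a) \<le> measure \<nu> (cball x e)"
proof -
  interpret prob_space \<nu> by fact
  obtain r \<delta> where r: "0 < r" "0 < \<delta>"
    and mass: "\<And>x e. x \<in> S \<Longrightarrow> 0 < e \<Longrightarrow> e \<le> r \<Longrightarrow>
      ennreal \<delta> * emeasure lebesgue (cball x e) \<le> emeasure \<nu> (cball x e \<inter> S)"
    using assms(1) unfolding standard_wrt_def by blast
  show thesis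
  proof (rule that[OF r(1)])
    show "0 < \<delta> * unit_ball_vol (real DIM('a))"
      using r by simp
    fix x :: 'a and e :: real assume x: "x \<in> S" "0 < e" "e \<le> r"
    have "ennreal \<delta> * emeasure lebesgue (cball x e) = ennreal (\<delta> * unit_ball_vol (real DIM('a)) * e ^ DIM('a))"
      using x r by (simp add: emeasure_cball ennreal_mult' mult.assoc)
    then have "ennreal (\<delta> * unit_ball_vol (real DIM('a)) * e ^ DIM('a)) \<le> emeasure \<nu> (cball x e \<inter> S)"
      using mass[OF x] by simp
    also have "\<dots> \<le> emeasure \<nu> (cball x e)"
      using assms(3) by (intro emeasure_mono) auto
    finally show "\<delta> * unit_ball_vol (real DIM('a)) * e ^ DIM('a) \<le> measure \<nu> (cball x e)"
      by (simp add: emeasure_eq_measure)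
  qed
qed

text \<open>Each point lies in \<open>S\<close> almost surely, and countably many null sets are
  discarded together.\<close>

lemma (in prob_space) AE_in_support:
  assumes "\<And>i. i \<ge> 1 \<Longrightarrow> X i \<in> borel_measurable M" "\<And>i. i \<ge> 1 \<Longrightarrow> distr M borel (X i) = P"
    and "is_support P S"
  shows "AE \<omega> in M. \<forall>i\<ge>(1::nat). X i \<omega> \<in> S"
proof -
  have "AE \<omega> in M. X i \<omega> \<in> S" if i: "1 \<le> i" for i
  proof -
    have S: "S \<in> sets borel" "measure P S = 1"
      using assms(3) by (auto simp: is_support_def)
    have "prob (X i -` S \<inter> space M) = 1"
      using measure_distr[OF assms(1)[OF i] S(1)] assms(2)[OF i] S(2) by simp
    then have "AE \<omega> in M. \<omega> \<in> X i -` S \<inter> space M"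
      using measurable_sets[OF assms(1)[OF i] S(1)] by (simp add: prob_eq_1)
    then show ?thesis by eventually_elim simp
  qed
  then have "\<forall>i. AE \<omega> in M. 1 \<le> i \<longrightarrow> X i \<omega> \<in> S"
    by auto
  then show ?thesis
    unfolding AE_all_countable .
qed

section \<open>Combining the almost sure covering rate with the stability of the hull\<close>

theorem corollary1:
  fixes S :: "(real ^ 2) set"
    and M :: "'w measure"
    and X :: "nat \<Rightarrow> 'w \<Rightarrow> real ^ 2"
    and P :: "(real ^ 2) measure"
  assumes "compact S"
    and "path_connected (frontier S)"
    and "S = closure (interior S)"
    and "prob_space M"
    and "prob_space.indep_vars M (\<lambda>_. borel) X {1..}"
    and "\<And>i. i \<ge> 1 \<Longrightarrow> distr M borel (X i) = P"
    and "is_support P S"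
    and "standard_wrt S P"
  shows "(\<forall>\<theta>\<in>{0..<pi / 2}. AE \<omega> in M.
            (\<lambda>n. hausdorff_distance
                   (biconvex_hull \<theta> ((\<lambda>i. X i \<omega>) ` {1..n})) (biconvex_hull \<theta> S))
              \<in> O(\<lambda>n. sqrt (ln (real n) / real n)) \<and>
            (\<lambda>n. hausdorff_distance
                   (frontier (biconvex_hull \<theta> S))
                   (frontier (biconvex_hull \<theta> ((\<lambda>i. X i \<omega>) ` {1..n}))))
              \<in> O(\<lambda>n. sqrt (ln (real n) / real n))) \<and>
         ((\<forall>\<theta>\<in>{0..<pi / 2}. \<exists>L. has_minkowski_content_frontier (biconvex_hull \<theta> S) L) \<longrightarrow>
          (\<forall>\<theta>\<in>{0..<pi / 2}. AE \<omega> in M.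
            (\<lambda>n. measure_distance
                   (biconvex_hull \<theta> ((\<lambda>i. X i \<omega>) ` {1..n})) (biconvex_hull \<theta> S))
              \<in> O(\<lambda>n. sqrt (ln (real n) / real n))))"
proof -
  interpret prob_space M by fact
  have rv: "X i \<in> borel_measurable M" if "1 \<le> i" for i
    using assms(5) that by (auto simp: indep_vars_def)
  have P: "prob_space P" "sets P = sets borel"
    using assms(6)[of 1] prob_space_distr[OF rv[of 1]] by auto
  have S: "connected S" "compact S"
    using assms(1,2) by (auto intro: connected_if_connected_frontier
        simp: compact_imp_closed compact_imp_bounded path_connected_imp_connected)
  have "S \<noteq> {}"
    using assms(7) by (auto simp: is_support_def)
  obtain r k where rk: "0 < r" "0 < k"
    and mass: "\<And>x e. x \<in> S \<Longrightarrow> 0 < e \<Longrightarrow> e \<le> r \<Longrightarrow> k * e ^ DIM(real ^ 2) \<le> measure P (cball x e)"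
    using standard_wrt_ball_mass[OF assms(8) P] by blast
  define e where "e n = 3 * (sqrt (3 / k) * sqrt (ln (real n) / real n))" for n :: nat
  have e_bigo: "e \<in> O(\<lambda>n. sqrt (ln (real n) / real n))"
    using rk by (intro bigoI[of _ "3 * sqrt (3 / k)"]) (simp add: e_def abs_mult)
  have e_lim: "e \<longlonglongrightarrow> 0"
    unfolding e_def by real_asymp
  \<comment> \<open>The range starts at 2, since \<open>ln 1 = 0\<close> makes \<open>e 1\<close>
    vanish.\<close>
  have e_pos: "\<forall>\<^sub>F n in sequentially. 0 < e n"
    using eventually_ge_at_top[of 2] by eventually_elim (use rk in \<open>simp add: e_def\<close>)
  have "AE \<omega> in M. \<forall>\<^sub>F n in sequentially. \<forall>s\<in>S. \<exists>i\<in>{1..n}. dist s (X i \<omega>) \<le> e n"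
    unfolding e_def using assms(5,6) rk mass by (intro iid_sample_covers) auto
  moreover have "AE \<omega> in M. \<forall>i\<ge>1. X i \<omega> \<in> S"
    using rv assms(6,7) by (rule AE_in_support)
  \<comment> \<open>One almost sure event, the same for every \<open>\<theta>\<close>; on it all
    three rates follow from the deterministic lemmas.\<close>
  ultimately have good: "AE \<omega> in M. (\<forall>n. (\<lambda>i. X i \<omega>) ` {1..n} \<subseteq> S) \<and>
      (\<forall>\<^sub>F n in sequentially. \<forall>s\<in>S. \<exists>a\<in>(\<lambda>i. X i \<omega>) ` {1..n}. dist s a \<le> e n)"
    by eventually_elim auto
  show ?thesis
  proof (intro conjI impI ballI)
    fix \<theta> :: real
    show "AE \<omega> in M.
            (\<lambda>n. hausdorff_distance
                   (biconvex_hull \<theta> ((\<lambda>i. X i \<omega>) ` {1..n})) (biconvex_hull \<theta> S))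
              \<in> O(\<lambda>n. sqrt (ln (real n) / real n)) \<and>
            (\<lambda>n. hausdorff_distance
                   (frontier (biconvex_hull \<theta> S))
                   (frontier (biconvex_hull \<theta> ((\<lambda>i. X i \<omega>) ` {1..n}))))
              \<in> O(\<lambda>n. sqrt (ln (real n) / real n))"
      using good
    proof eventually_elim
      case (elim \<omega>)
      then show ?case
        using hausdorff_distance_biconvex_hull_bigo[OF S \<open>S \<noteq> {}\<close> _ e_pos,
            of "\<lambda>n. (\<lambda>i. X i \<omega>) ` {1..n}"] landau_o.big_trans[OF _ e_bigo]
        by blast
    qed
  next
    fix \<theta> :: real
    assume "\<forall>\<theta>\<in>{0..<pi / 2}. \<exists>L. has_minkowski_content_frontier (biconvex_hull \<theta> S) L" "\<theta> \<in> {0..<pi / 2}"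
    then obtain L where L: "has_minkowski_content_frontier (biconvex_hull \<theta> S) L" by blast
    show "AE \<omega> in M.
            (\<lambda>n. measure_distance
                   (biconvex_hull \<theta> ((\<lambda>i. X i \<omega>) ` {1..n})) (biconvex_hull \<theta> S))
              \<in> O(\<lambda>n. sqrt (ln (real n) / real n))"
      using good
    proof eventually_elim
      case (elim \<omega>)
      then show ?case
        using measure_distance_biconvex_hull_bigo[OF S _ e_pos e_lim _ L,
            of "\<lambda>n. (\<lambda>i. X i \<omega>) ` {1..n}"] landau_o.big_trans[OF _ e_bigo]
        by blast
    qed
  qed
qed

end
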